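(* Let $(X,d)$ be a complete, proper, separable metric space which is a length space, let $P$ be a Markov probability kernel on $X$, and let $C>0$. The following are equivalent: (1) (Reverse logarithmic Sobolev inequality) $$Pf\,|\nabla\ln Pf|^2\le C\left(P(f\ln f)-(Pf)\ln Pf\right)\quad\text{pointwise on }X,\qquad \text{for all } f\in\mathrm{Lip}_b(X),\ f>0.$$ (2) (Entropic transportation-cost inequalities) $$T_{0,\kappa C}(\mu_0P,\mu_1P)\le T_{\kappa,\kappa C}(\mu_0,\mu_1),\qquad\text{for all }\mu_0,\mu_1\in\mathcal P(X),\ \kappa>0.$$ (3) (Wang-type Harnack inequality) $$(Pf(x))^p\le\exp\left(\frac{p}{p-1}\,\frac{C\,d(x,y)^2}{4}\right)P(f^p)(y),\qquad\text{for all } p>1,\ f\in\mathrm{Lip}_b(X),\ f>0,\ x,y\in X.$$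
   Context: For $f:X\to\mathbb R$, $|\nabla f|(x)=\lim_{r\to0}\sup_{0<d(x,y)\le r}\frac{|f(x)-f(y)|}{d(x,y)}$. $\mathrm{Lip}_b(X)$ is the Banach space of bounded Lipschitz functions on $X$ and $\mathcal P(X)$ the set of Borel probability measures on $X$. The Markov kernel $P:X\times\mathcal B_X\to[0,1]$ acts by $Pf(x)=\int_X f(y)\,P(x,dy)$ and $\mu P(A)=\int_X P(x,A)\,\mu(dx)$. For $a,b\ge0$ let $\mathcal E_{a,b}$ be the class of all positive functions $\varphi\in C^1([0,1],\mathrm{Lip}_b(X))$, bounded and bounded away from $0$, satisfying $\partial_s\varphi_s+a\varphi_s|\nabla\ln\varphi_s|^2+b\varphi_s\ln\varphi_s\le0$. For $\mu_0,\mu_1\in\mathcal P(X)$ set $T_{a,b}(\mu_0,\mu_1)=\sup_{\varphi\in\mathcal E_{a,b}}\left[\int_X\varphi_1\,d\mu_1-\int_X\varphi_0\,d\mu_0\right]$ (possibly $+\infty$). *)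

theory Defs
  imports "HOL-Probability.Probability"
begin

section \<open>Length spaces\<close>

definition curve_length :: "(real \<Rightarrow> 'a::metric_space) \<Rightarrow> ennreal" where
  "curve_length \<gamma> =
     (SUP ts\<in>{ts. sorted ts \<and> set ts \<subseteq> {0..1}}.
        \<Sum>i<length ts - 1. ennreal (dist (\<gamma> (ts ! i)) (\<gamma> (ts ! Suc i))))"

text \<open>The infimum over the empty set is infinite in \<^typ>\<open>ennreal\<close>, so a length space is
  path connected.\<close>

definition length_space :: "'a::metric_space itself \<Rightarrow> bool" where
  "length_space _ \<longleftrightarrow>
     (\<forall>x y::'a. ennreal (dist x y) =
        (INF \<gamma>\<in>{\<gamma>. path \<gamma> \<and> pathstart \<gamma> = x \<and> pathfinish \<gamma> = y}. curve_length \<gamma>))"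

section \<open>The pointwise Lipschitz constant\<close>

text \<open>The gradient length \<open>|\<nabla>f|(x)\<close> may be infinite, since \<open>f\<close> is arbitrary here (a Markov kernel
  need not map Lipschitz functions to Lipschitz functions). At an isolated point the supremum is
  over the empty set, hence the value is \<open>0\<close>. The limit exists by monotonicity in \<open>r\<close>.\<close>

definition grad_len :: "('a::metric_space \<Rightarrow> real) \<Rightarrow> 'a \<Rightarrow> ennreal" where
  "grad_len f x =
     Lim (at_right 0) (\<lambda>r::real.
       SUP y\<in>{y. 0 < dist x y \<and> dist x y \<le> r}. ennreal (\<bar>f x - f y\<bar> / dist x y))"

lemma grad_len_tendsto:
  "((\<lambda>r::real. SUP y\<in>{y. 0 < dist x y \<and> dist x y \<le> r}. ennreal (\<bar>f x - f y\<bar> / dist x y))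
      \<longlongrightarrow> grad_len f x) (at_right 0)"
proof -
  define S where
    "S r = (SUP y\<in>{y. 0 < dist x y \<and> dist x y \<le> r}. ennreal (\<bar>f x - f y\<bar> / dist x y))" for r
  have mono: "S r \<le> S r'" if "r \<le> r'" for r r'
    unfolding S_def by (rule SUP_subset_mono) (use that in auto)
  have "(S \<longlongrightarrow> (INF r\<in>{0<..}. S r)) (at_right 0)"
  proof (rule order_tendstoI)
    fix a assume a: "a < (INF r\<in>{0<..}. S r)"
    have "a < S r" if "r > 0" for r
      using that by (intro less_le_trans[OF a] INF_lower) auto
    thus "\<forall>\<^sub>F r in at_right 0. a < S r"
      by (auto simp: eventually_at_right_field intro!: exI[of _ 1])
  next
    fix a assume "(INF r\<in>{0<..}. S r) < a"
    then obtain r where r: "r > 0" "S r < a" by (auto simp: INF_less_iff)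
    have "S r' < a" if "r' < r" for r'
      using mono[of r' r] r that by auto
    thus "\<forall>\<^sub>F r in at_right 0. S r < a"
      using r by (auto simp: eventually_at_right_field intro!: exI[of _ r])
  qed
  hence "(S \<longlongrightarrow> Lim (at_right 0) S) (at_right 0)"
    by (metis tendsto_Lim trivial_limit_at_right_real)
  thus ?thesis unfolding grad_len_def S_def .
qed

section \<open>The normed space of bounded Lipschitz functions\<close>

definition Lip_b :: "('a::metric_space \<Rightarrow> real) set" where
  "Lip_b = {f. bounded (range f) \<and> (\<exists>L. L-lipschitz_on UNIV f)}"

typedef (overloaded) 'a lipb = "Lip_b :: ('a::metric_space \<Rightarrow> real) set"
  morphisms apply_lipb Abs_lipb
proof
  show "(\<lambda>_. 0) \<in> Lip_b"
    by (auto simp: Lip_b_def intro!: exI[of _ 0] lipschitz_on_constant)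
qed

setup_lifting type_definition_lipb

definition sup_abs :: "('a \<Rightarrow> real) \<Rightarrow> real" where
  "sup_abs f = (SUP x. \<bar>f x\<bar>)"

definition lip_const :: "('a::metric_space \<Rightarrow> real) \<Rightarrow> real" where
  "lip_const f = Inf {L. L-lipschitz_on UNIV f}"

lemma Lip_b_bdd_above: "f \<in> Lip_b \<Longrightarrow> bdd_above (range (\<lambda>x. \<bar>f x\<bar>))"
  by (auto simp: Lip_b_def bounded_iff bdd_above_def)

lemma abs_le_sup_abs: "f \<in> Lip_b \<Longrightarrow> \<bar>f x\<bar> \<le> sup_abs f"
  unfolding sup_abs_def by (intro cSUP_upper Lip_b_bdd_above) auto

lemma sup_abs_le: "(\<And>x. \<bar>f x\<bar> \<le> B) \<Longrightarrow> sup_abs f \<le> B"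
  unfolding sup_abs_def by (intro cSUP_least) auto

lemma lip_const_le: "L-lipschitz_on UNIV f \<Longrightarrow> lip_const f \<le> L"
  unfolding lip_const_def
  by (intro cInf_lower) (auto simp: bdd_below_def intro: lipschitz_on_nonneg)

lemma lip_const_nonneg: "f \<in> Lip_b \<Longrightarrow> 0 \<le> lip_const f"
  unfolding lip_const_def
  by (intro cInf_greatest) (auto simp: Lip_b_def intro: lipschitz_on_nonneg)

lemma lipschitz_on_lip_const:
  assumes "f \<in> Lip_b"
  shows "(lip_const f)-lipschitz_on UNIV f"
proof (rule lipschitz_onI)
  show "0 \<le> lip_const f" by (rule lip_const_nonneg[OF assms])
next
  fix x y
  show "dist (f x) (f y) \<le> lip_const f * dist x y"
  proof (cases "x = y")
    case False
    have "dist (f x) (f y) / dist x y \<le> lip_const f"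
      unfolding lip_const_def
      using assms False
      by (intro cInf_greatest) (auto simp: Lip_b_def divide_simps dest: lipschitz_onD)
    thus ?thesis using False by (simp add: divide_simps split: if_splits)
  qed simp
qed

lemma Lip_b_const: "(\<lambda>_. c) \<in> Lip_b"
  by (auto simp: Lip_b_def intro!: exI[of _ 0] lipschitz_on_constant)

lemma Lip_b_add: "f \<in> Lip_b \<Longrightarrow> g \<in> Lip_b \<Longrightarrow> (\<lambda>x. f x + g x) \<in> Lip_b"
  by (auto simp: Lip_b_def intro: lipschitz_on_add bounded_plus_comp)

lemma Lip_b_scale:
  assumes "f \<in> Lip_b"
  shows "(\<lambda>x. c * f x) \<in> Lip_b"
proof -
  have "bounded (range (\<lambda>x. c * f x))"
    using assms bounded_scaling[of "range f" c]
    by (simp add: Lip_b_def image_image)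
  thus ?thesis using assms by (auto simp: Lip_b_def intro: lipschitz_on_cmult_real)
qed

lemma Lip_b_minus: "f \<in> Lip_b \<Longrightarrow> (\<lambda>x. - f x) \<in> Lip_b"
  using Lip_b_scale[of f "-1"] by simp

lemma Lip_b_diff: "f \<in> Lip_b \<Longrightarrow> g \<in> Lip_b \<Longrightarrow> (\<lambda>x. f x - g x) \<in> Lip_b"
  using Lip_b_add[OF _ Lip_b_minus] by fastforce

lemma sup_abs_add: "f \<in> Lip_b \<Longrightarrow> g \<in> Lip_b \<Longrightarrow> sup_abs (\<lambda>x. f x + g x) \<le> sup_abs f + sup_abs g"
  by (intro sup_abs_le abs_triangle_ineq[THEN order_trans] add_mono abs_le_sup_abs)

lemma lip_const_add: "f \<in> Lip_b \<Longrightarrow> g \<in> Lip_b \<Longrightarrow> lip_const (\<lambda>x. f x + g x) \<le> lip_const f + lip_const g"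
  by (intro lip_const_le lipschitz_on_add lipschitz_on_lip_const)

lemma sup_abs_scale_le: "f \<in> Lip_b \<Longrightarrow> sup_abs (\<lambda>x. c * f x) \<le> \<bar>c\<bar> * sup_abs f"
  by (intro sup_abs_le) (simp add: abs_mult mult_left_mono abs_le_sup_abs)

lemma lip_const_scale_le: "f \<in> Lip_b \<Longrightarrow> lip_const (\<lambda>x. c * f x) \<le> \<bar>c\<bar> * lip_const f"
  by (intro lip_const_le lipschitz_on_cmult_real lipschitz_on_lip_const)

lemma scale_eqI:
  fixes N :: "('a::metric_space \<Rightarrow> real) \<Rightarrow> real"
  assumes le: "\<And>c f. f \<in> Lip_b \<Longrightarrow> N (\<lambda>x. c * f x) \<le> \<bar>c\<bar> * N f"
    and nn: "\<And>f. f \<in> Lip_b \<Longrightarrow> 0 \<le> N f" and f: "f \<in> Lip_b"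
  shows "N (\<lambda>x. c * f x) = \<bar>c\<bar> * N f"
proof (cases "c = 0")
  case True
  thus ?thesis using le[OF f, of 0] nn[OF Lip_b_const[of 0]] by simp
next
  case False
  have "N f \<le> \<bar>inverse c\<bar> * N (\<lambda>x. c * f x)"
    using le[OF Lip_b_scale[OF f, of c], of "inverse c"] False by (simp add: mult.assoc[symmetric])
  hence "\<bar>c\<bar> * N f \<le> N (\<lambda>x. c * f x)"
    using False by (simp add: field_simps)
  thus ?thesis using le[OF f, of c] by simp
qed

lemma sup_abs_nonneg: "f \<in> Lip_b \<Longrightarrow> 0 \<le> sup_abs f"
  using abs_le_sup_abs order_trans abs_ge_zero by blast

instantiation lipb :: (metric_space) real_normed_vector
begin

lift_definition zero_lipb :: "'a lipb" is "\<lambda>_. 0" by (rule Lip_b_const)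
lift_definition plus_lipb :: "'a lipb \<Rightarrow> 'a lipb \<Rightarrow> 'a lipb" is "\<lambda>f g x. f x + g x"
  by (rule Lip_b_add)
lift_definition minus_lipb :: "'a lipb \<Rightarrow> 'a lipb \<Rightarrow> 'a lipb" is "\<lambda>f g x. f x - g x"
  by (rule Lip_b_diff)
lift_definition uminus_lipb :: "'a lipb \<Rightarrow> 'a lipb" is "\<lambda>f x. - f x"
  by (rule Lip_b_minus)
lift_definition scaleR_lipb :: "real \<Rightarrow> 'a lipb \<Rightarrow> 'a lipb" is "\<lambda>c f x. c * f x"
  by (rule Lip_b_scale)
lift_definition norm_lipb :: "'a lipb \<Rightarrow> real" is "\<lambda>f. sup_abs f + lip_const f" .

definition dist_lipb :: "'a lipb \<Rightarrow> 'a lipb \<Rightarrow> real" where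
  "dist_lipb f g = norm (f - g)"
definition sgn_lipb :: "'a lipb \<Rightarrow> 'a lipb" where
  "sgn_lipb f = inverse (norm f) *\<^sub>R f"
definition uniformity_lipb :: "('a lipb \<times> 'a lipb) filter" where
  "uniformity_lipb = (INF e\<in>{0<..}. principal {(x, y). dist x y < e})"
definition open_lipb :: "'a lipb set \<Rightarrow> bool" where
  "open_lipb S = (\<forall>x\<in>S. \<forall>\<^sub>F (x', y) in uniformity. x' = x \<longrightarrow> y \<in> S)"

instance
proof
  fix f g h :: "'a lipb" and a b :: real
  show "f + g + h = f + (g + h)" by transfer (simp add: add.assoc)
  show "f + g = g + f" by transfer (simp add: add.commute)
  show "0 + f = f" by transfer simp
  show "- f + f = 0" by transfer simp
  show "f - g = f + - g" by transfer simp
  show "a *\<^sub>R (f + g) = a *\<^sub>R f + a *\<^sub>R g" by transfer (simp add: algebra_simps)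
  show "(a + b) *\<^sub>R f = a *\<^sub>R f + b *\<^sub>R f" by transfer (simp add: algebra_simps)
  show "a *\<^sub>R b *\<^sub>R f = (a * b) *\<^sub>R f" by transfer (simp add: mult.assoc)
  show "1 *\<^sub>R f = f" by transfer simp
  show "dist f g = norm (f - g)" by (rule dist_lipb_def)
  show "sgn f = inverse (norm f) *\<^sub>R f" by (rule sgn_lipb_def)
  show "uniformity = (INF e\<in>{0<..}. principal {(x, y::'a lipb). dist x y < e})"
    by (rule uniformity_lipb_def)
  show "open S = (\<forall>x\<in>S. \<forall>\<^sub>F (x', y) in uniformity. x' = x \<longrightarrow> y \<in> S)" for S :: "'a lipb set"
    by (rule open_lipb_def)
  show "norm f = 0 \<longleftrightarrow> f = 0"
  proof transfer
    fix f :: "'a \<Rightarrow> real" assume f: "f \<in> Lip_b"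
    show "sup_abs f + lip_const f = 0 \<longleftrightarrow> f = (\<lambda>_. 0)"
    proof
      assume "sup_abs f + lip_const f = 0"
      hence "sup_abs f = 0" using sup_abs_nonneg[OF f] lip_const_nonneg[OF f] by simp
      thus "f = (\<lambda>_. 0)" using abs_le_sup_abs[OF f] by auto
    next
      assume eq: "f = (\<lambda>_. 0)"
      have "sup_abs f \<le> 0" "lip_const f \<le> 0"
        unfolding eq by (auto intro!: sup_abs_le lip_const_le lipschitz_on_constant)
      thus "sup_abs f + lip_const f = 0"
        using sup_abs_nonneg[OF f] lip_const_nonneg[OF f] by simp
    qed
  qed
  show "norm (f + g) \<le> norm f + norm g"
  proof transfer
    fix f g :: "'a \<Rightarrow> real" assume "f \<in> Lip_b" "g \<in> Lip_b"
    thus "sup_abs (\<lambda>x. f x + g x) + lip_const (\<lambda>x. f x + g x)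
        \<le> sup_abs f + lip_const f + (sup_abs g + lip_const g)"
      using sup_abs_add[of f g] lip_const_add[of f g] by linarith
  qed
  show "norm (a *\<^sub>R f) = \<bar>a\<bar> * norm f"
  proof transfer
    fix a and f :: "'a \<Rightarrow> real" assume f: "f \<in> Lip_b"
    show "sup_abs (\<lambda>x. a * f x) + lip_const (\<lambda>x. a * f x) = \<bar>a\<bar> * (sup_abs f + lip_const f)"
      using scale_eqI[of sup_abs, OF sup_abs_scale_le sup_abs_nonneg f]
        scale_eqI[of lip_const, OF lip_const_scale_le lip_const_nonneg f]
      by (simp add: distrib_left)
  qed
qed

end

section \<open>Markov kernels and the transportation cost\<close>

abbreviation prob_measures :: "'a::topological_space measure set" where
  "prob_measures \<equiv> space (prob_algebra borel)"

text \<open>The action \<open>\<mu>P\<close> on measures is the bind \<open>\<mu> \<bind> P\<close> of the Giry monad.\<close>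

definition markov_kernel :: "('a::topological_space \<Rightarrow> 'a measure) \<Rightarrow> bool" where
  "markov_kernel P \<longleftrightarrow> P \<in> borel \<rightarrow>\<^sub>M prob_algebra borel"

definition kernel_app :: "('a \<Rightarrow> 'a measure) \<Rightarrow> ('a \<Rightarrow> real) \<Rightarrow> 'a \<Rightarrow> real" where
  "kernel_app P f x = (\<integral>y. f y \<partial>P x)"

text \<open>The differential inequality is stated in \<^typ>\<open>ereal\<close> only because of the type of
  \<^const>\<open>grad_len\<close>: every term is finite, as \<open>ln \<circ> \<phi> s\<close> is Lipschitz.
  Only the values of \<open>\<phi>\<close> on \<open>[0,1]\<close> matter; derivatives at the end points are one-sided.\<close>

definition E_class :: "real \<Rightarrow> real \<Rightarrow> (real \<Rightarrow> 'a::metric_space lipb) set" where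
  "E_class a b = {\<phi>.
     (\<exists>m M. 0 < m \<and> (\<forall>s\<in>{0..1}. \<forall>x. m \<le> apply_lipb (\<phi> s) x \<and> apply_lipb (\<phi> s) x \<le> M)) \<and>
     (\<exists>\<phi>'. continuous_on {0..1} \<phi>' \<and>
        (\<forall>s\<in>{0..1}. (\<phi> has_vector_derivative \<phi>' s) (at s within {0..1})) \<and>
        (\<forall>s\<in>{0..1}. \<forall>x.
           ereal (apply_lipb (\<phi>' s) x)
             + ereal (a * apply_lipb (\<phi> s) x) * (enn2ereal (grad_len (\<lambda>z. ln (apply_lipb (\<phi> s) z)) x))\<^sup>2
             + ereal (b * (apply_lipb (\<phi> s) x * ln (apply_lipb (\<phi> s) x))) \<le> 0))}"

definition T_cost :: "real \<Rightarrow> real \<Rightarrow> 'a::metric_space measure \<Rightarrow> 'a measure \<Rightarrow> ereal" where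
  "T_cost a b \<mu>0 \<mu>1 =
     (SUP \<phi>\<in>E_class a b. ereal ((\<integral>x. apply_lipb (\<phi> 1) x \<partial>\<mu>1) - (\<integral>x. apply_lipb (\<phi> 0) x \<partial>\<mu>0)))"

section \<open>The three inequalities\<close>

text \<open>Since \<^term>\<open>kernel_app P f\<close> need not be Lipschitz, the left-hand side may a priori be infinite.\<close>

definition reverse_log_sobolev :: "('a::metric_space \<Rightarrow> 'a measure) \<Rightarrow> real \<Rightarrow> bool" where
  "reverse_log_sobolev P C \<longleftrightarrow>
     (\<forall>f\<in>Lip_b. (\<forall>x. 0 < f x) \<longrightarrow>
       (\<forall>x. ereal (kernel_app P f x) * (enn2ereal (grad_len (\<lambda>z. ln (kernel_app P f z)) x))\<^sup>2
            \<le> ereal (C * (kernel_app P (\<lambda>y. f y * ln (f y)) x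
                          - kernel_app P f x * ln (kernel_app P f x)))))"

definition entropic_transport_ineq :: "('a::metric_space \<Rightarrow> 'a measure) \<Rightarrow> real \<Rightarrow> bool" where
  "entropic_transport_ineq P C \<longleftrightarrow>
     (\<forall>\<mu>0\<in>prob_measures. \<forall>\<mu>1\<in>prob_measures. \<forall>\<kappa>>0.
        T_cost 0 (\<kappa> * C) (\<mu>0 \<bind> P) (\<mu>1 \<bind> P) \<le> T_cost \<kappa> (\<kappa> * C) \<mu>0 \<mu>1)"

definition wang_harnack :: "('a::metric_space \<Rightarrow> 'a measure) \<Rightarrow> real \<Rightarrow> bool" where
  "wang_harnack P C \<longleftrightarrow>
     (\<forall>p>1. \<forall>f\<in>Lip_b. (\<forall>x. 0 < f x) \<longrightarrow>
       (\<forall>x y. kernel_app P f x powr p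
            \<le> exp (p / (p - 1) * (C * (dist x y)\<^sup>2 / 4)) * kernel_app P (\<lambda>z. f z powr p) y))"

end

theory Submission
  imports Defs
begin

text \<open>
  The equivalence is proved as a cycle.

  Reverse logarithmic Sobolev implies entropic transport (\<open>entropic_transport\<close>). The
  inequality controls the slope of \<open>ln (P f)\<close>, so \<open>P\<close> is bounded on the space of bounded Lipschitz
  functions and preserves \<open>C\<^sup>1\<close> curves in it. For a curve \<open>\<phi>\<close> in \<open>E_class 0 (\<kappa> * C)\<close>, the inequality
  says precisely that the extra slope term for \<open>P \<phi>\<close> is paid for by the convexity defect
  \<open>P (\<phi> ln \<phi>) - P \<phi> ln (P \<phi>)\<close>. So \<open>P \<phi>\<close> belongs to \<open>E_class \<kappa> (\<kappa> * C)\<close>, and it competes in the second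
  supremum with the same value as \<open>\<phi>\<close> in the first.

  Entropic transport implies Harnack (\<open>wang_harnack\<close>). Test on Dirac measures. The curve
  \<open>f powr (exp (- b s))\<close> belongs to \<open>E_class 0 b\<close> and connects a \<open>p\<close>-th power with its base if
  \<open>p = exp b\<close>; it gives a lower bound for the first supremum. For the second supremum,
  \<open>exp (b s) ln \<phi>\<^sub>s\<close> is a subsolution of a Hamilton-Jacobi equation, and comparison with the Hopf-Lax
  solution (\<open>hamilton_jacobi_bound\<close>) bounds \<open>\<phi>\<^sub>1 x powr p\<close> by \<open>\<phi>\<^sub>0 y\<close> times the
  Harnack constant. Optimising over multiples of \<open>f\<close> makes the two bounds match.

  Harnack implies reverse logarithmic Sobolev (\<open>reverse_log_sobolev\<close>). Linearise: let \<open>p\<close> tend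
  to \<open>1\<close> proportionally to \<open>d(x, y)\<close>. With proportionality factor \<open>lam\<close> this bounds the slope of
  \<open>ln (P f)\<close> by \<open>C / (4 lam) + lam E\<close>, where \<open>E\<close> is the entropy divided by \<open>P f\<close>, and optimising over \<open>lam\<close>
  gives the square root of \<open>C E\<close>.

  The geometry of the space enters through maximum principles: closed balls are compact, so the
  maxima exist, and in a length space the distance from a point has descending slope \<open>1\<close>, which gives
  the slope at a maximum (\<open>grad_len_ge_descent\<close>).
\<close>

section \<open>The Banach algebra of bounded Lipschitz functions\<close>

lemma norm_lipb_eq:
  "norm f = sup_abs (apply_lipb f) + lip_const (apply_lipb f)"
  by (simp add: norm_lipb.rep_eq)

lemma apply_lipb_in_Lip_b [simp]: "apply_lipb f \<in> Lip_b"
  using apply_lipb by blast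

lemma abs_apply_lipb_le: "\<bar>apply_lipb f x\<bar> \<le> norm f"
  using abs_le_sup_abs[OF apply_lipb_in_Lip_b[of f], of x]
    lip_const_nonneg[OF apply_lipb_in_Lip_b[of f]]
  by (simp add: norm_lipb_eq)

lemma dist_apply_lipb_le: "\<bar>apply_lipb f x - apply_lipb f y\<bar> \<le> norm f * dist x y"
proof -
  have "\<bar>apply_lipb f x - apply_lipb f y\<bar> \<le> lip_const (apply_lipb f) * dist x y"
    using lipschitz_onD[OF lipschitz_on_lip_const[OF apply_lipb_in_Lip_b]]
    by (auto simp: dist_real_def)
  also have "\<dots> \<le> norm f * dist x y"
    using sup_abs_nonneg[OF apply_lipb_in_Lip_b] by (intro mult_right_mono) (auto simp: norm_lipb_eq)
  finally show ?thesis .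
qed

lemma Lip_bI:
  assumes "\<And>x. \<bar>f x\<bar> \<le> B" "0 \<le> L" "\<And>x y. \<bar>f x - f y\<bar> \<le> L * dist x y"
  shows "f \<in> Lip_b"
proof -
  have "L-lipschitz_on UNIV f" using assms by (intro lipschitz_onI) (auto simp: dist_real_def)
  moreover have "bounded (range f)" using assms(1) by (auto simp: bounded_iff)
  ultimately show ?thesis by (auto simp: Lip_b_def)
qed

lemma norm_lipb_le:
  assumes "\<And>x. \<bar>apply_lipb f x\<bar> \<le> B" "0 \<le> L"
    "\<And>x y. \<bar>apply_lipb f x - apply_lipb f y\<bar> \<le> L * dist x y"
  shows "norm f \<le> B + L"
  unfolding norm_lipb_eq using assms
  by (intro add_mono sup_abs_le lip_const_le lipschitz_onI) (auto simp: dist_real_def)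

lemma abs_diff_prod_le:
  fixes a b c d :: real
  shows "\<bar>a * b - c * d\<bar> \<le> \<bar>a\<bar> * \<bar>b - d\<bar> + \<bar>d\<bar> * \<bar>a - c\<bar>"
proof -
  have "a * b - c * d = a * (b - d) + d * (a - c)" by (simp add: algebra_simps)
  thus ?thesis by (metis abs_triangle_ineq abs_mult)
qed

lemma prod_lipschitz:
  assumes "f \<in> Lip_b" "g \<in> Lip_b"
  shows "\<bar>f x * g x - f y * g y\<bar>
           \<le> (sup_abs f * lip_const g + sup_abs g * lip_const f) * dist x y"
proof -
  have l: "\<bar>h x - h y\<bar> \<le> lip_const h * dist x y" if "h \<in> Lip_b" for h :: "'a \<Rightarrow> real"
    using lipschitz_onD[OF lipschitz_on_lip_const[OF that]] by (auto simp: dist_real_def)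
  have "\<bar>f x * g x - f y * g y\<bar> \<le> \<bar>f x\<bar> * \<bar>g x - g y\<bar> + \<bar>g y\<bar> * \<bar>f x - f y\<bar>"
    by (rule abs_diff_prod_le)
  also have "\<dots> \<le> sup_abs f * (lip_const g * dist x y) + sup_abs g * (lip_const f * dist x y)"
    using assms by (intro add_mono mult_mono abs_le_sup_abs l sup_abs_nonneg) auto
  finally show ?thesis by (simp add: algebra_simps)
qed

lemma Lip_b_mult:
  assumes "f \<in> Lip_b" "g \<in> Lip_b"
  shows "(\<lambda>x. f x * g x) \<in> Lip_b"
proof (rule Lip_bI)
  show "\<bar>f x * g x\<bar> \<le> sup_abs f * sup_abs g" for x
    unfolding abs_mult using assms by (intro mult_mono abs_le_sup_abs sup_abs_nonneg) auto
  show "0 \<le> sup_abs f * lip_const g + sup_abs g * lip_const f"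
    using assms by (simp add: sup_abs_nonneg lip_const_nonneg)
qed (rule prod_lipschitz[OF assms])

text \<open>The Leibniz bound on the Lipschitz constant of a product makes the norm of \<^typ>\<open>'a lipb\<close>
  submultiplicative. The exponential of this algebra then yields smooth curves of Lipschitz
  functions, together with their derivatives in the norm.\<close>

instantiation lipb :: (metric_space) real_normed_algebra_1
begin

lift_definition one_lipb :: "'a lipb" is "\<lambda>_. 1" by (rule Lip_b_const)
lift_definition times_lipb :: "'a lipb \<Rightarrow> 'a lipb \<Rightarrow> 'a lipb" is "\<lambda>f g x. f x * g x"
  by (rule Lip_b_mult)

instance
proof
  fix f g h :: "'a lipb" and a :: real
  show "f * g * h = f * (g * h)" by transfer (simp add: mult.assoc)
  show "1 * f = f" by transfer simp
  show "f * 1 = f" by transfer simp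
  show "(f + g) * h = f * h + g * h" by transfer (simp add: algebra_simps)
  show "f * (g + h) = f * g + f * h" by transfer (simp add: algebra_simps)
  show "(0::'a lipb) \<noteq> 1" by transfer (metis zero_neq_one)
  show "a *\<^sub>R f * g = a *\<^sub>R (f * g)" by transfer (simp add: mult.assoc)
  show "f * a *\<^sub>R g = a *\<^sub>R (f * g)" by transfer (simp add: algebra_simps)
  have "norm (1::'a lipb) \<le> 1 + 0"
    by (rule norm_lipb_le) (auto simp: one_lipb.rep_eq)
  moreover have "1 \<le> norm (1::'a lipb)"
    using abs_apply_lipb_le[of 1 undefined] by (simp add: one_lipb.rep_eq)
  ultimately show "norm (1::'a lipb) = 1" by simp
  define sf sg lf lg where defs: "sf = sup_abs (apply_lipb f)" "sg = sup_abs (apply_lipb g)"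
    "lf = lip_const (apply_lipb f)" "lg = lip_const (apply_lipb g)"
  have nn: "0 \<le> sf" "0 \<le> sg" "0 \<le> lf" "0 \<le> lg"
    by (simp_all add: defs sup_abs_nonneg lip_const_nonneg)
  have "norm (f * g) \<le> sf * sg + (sf * lg + sg * lf)"
  proof (rule norm_lipb_le)
    show "\<bar>apply_lipb (f * g) x\<bar> \<le> sf * sg" for x
      unfolding times_lipb.rep_eq abs_mult defs
      by (intro mult_mono abs_le_sup_abs sup_abs_nonneg) auto
    show "0 \<le> sf * lg + sg * lf" using nn by simp
    show "\<bar>apply_lipb (f * g) x - apply_lipb (f * g) y\<bar> \<le> (sf * lg + sg * lf) * dist x y" for x y
      unfolding times_lipb.rep_eq defs by (intro prod_lipschitz) auto
  qed
  also have "\<dots> \<le> (sf + lf) * (sg + lg)"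
    using nn by (simp add: algebra_simps)
  finally show "norm (f * g) \<le> norm f * norm g"
    by (simp add: norm_lipb_eq defs)
qed

end

instance lipb :: (metric_space) banach
proof
  fix X :: "nat \<Rightarrow> 'a lipb" assume X: "Cauchy X"
  have close: "\<exists>N. \<forall>m\<ge>N. \<forall>n\<ge>N. norm (X m - X n) < e" if "0 < e" for e
    using metric_CauchyD[OF X that] by (simp add: dist_norm)
  define f where "f x = lim (\<lambda>n. apply_lipb (X n) x)" for x
  have f: "(\<lambda>n. apply_lipb (X n) x) \<longlonglongrightarrow> f x" for x
  proof -
    have "Cauchy (\<lambda>n. apply_lipb (X n) x)"
    proof (rule CauchyI)
      fix e :: real assume "0 < e"
      then obtain N where N: "\<And>m n. m \<ge> N \<Longrightarrow> n \<ge> N \<Longrightarrow> norm (X m - X n) < e"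
        using close by blast
      have "norm (apply_lipb (X m) x - apply_lipb (X n) x) \<le> norm (X m - X n)" for m n
        using abs_apply_lipb_le[of "X m - X n" x] by (simp add: minus_lipb.rep_eq)
      with N show "\<exists>N. \<forall>m\<ge>N. \<forall>n\<ge>N. norm (apply_lipb (X m) x - apply_lipb (X n) x) < e"
        by (meson le_less_trans)
    qed
    thus ?thesis
      unfolding f_def using Cauchy_convergent_iff convergent_LIMSEQ_iff by blast
  qed
  \<comment> \<open>Both estimates on \<open>X m - X n\<close> survive the pointwise limit \<open>m \<rightarrow> \<infinity>\<close>.\<close>
  have lim: "\<exists>N. \<forall>n\<ge>N. (\<forall>x. \<bar>f x - apply_lipb (X n) x\<bar> \<le> e) \<and>
      (\<forall>x y. \<bar>(f x - apply_lipb (X n) x) - (f y - apply_lipb (X n) y)\<bar> \<le> e * dist x y)"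
    if e: "0 < e" for e
  proof -
    obtain N where N: "\<And>m n. m \<ge> N \<Longrightarrow> n \<ge> N \<Longrightarrow> norm (X m - X n) < e"
      using close[OF e] by blast
    have "\<bar>f x - apply_lipb (X n) x\<bar> \<le> e" if n: "n \<ge> N" for n x
    proof (rule LIMSEQ_le_const2)
      show "(\<lambda>m. \<bar>apply_lipb (X m) x - apply_lipb (X n) x\<bar>) \<longlonglongrightarrow> \<bar>f x - apply_lipb (X n) x\<bar>"
        by (intro tendsto_intros f)
      show "\<exists>M. \<forall>m\<ge>M. \<bar>apply_lipb (X m) x - apply_lipb (X n) x\<bar> \<le> e"
      proof (intro exI allI impI)
        fix m assume "m \<ge> N"
        thus "\<bar>apply_lipb (X m) x - apply_lipb (X n) x\<bar> \<le> e"
          using N[of m n] n abs_apply_lipb_le[of "X m - X n" x] by (simp add: minus_lipb.rep_eq)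
      qed
    qed
    moreover have "\<bar>(f x - apply_lipb (X n) x) - (f y - apply_lipb (X n) y)\<bar> \<le> e * dist x y"
      if n: "n \<ge> N" for n x y
    proof (rule LIMSEQ_le_const2)
      show "(\<lambda>m. \<bar>(apply_lipb (X m) x - apply_lipb (X n) x) - (apply_lipb (X m) y - apply_lipb (X n) y)\<bar>)
          \<longlonglongrightarrow> \<bar>(f x - apply_lipb (X n) x) - (f y - apply_lipb (X n) y)\<bar>"
        by (intro tendsto_intros f)
      show "\<exists>M. \<forall>m\<ge>M. \<bar>(apply_lipb (X m) x - apply_lipb (X n) x)
          - (apply_lipb (X m) y - apply_lipb (X n) y)\<bar> \<le> e * dist x y"
      proof (intro exI allI impI)
        fix m assume "m \<ge> N"
        have "\<bar>apply_lipb (X m - X n) x - apply_lipb (X m - X n) y\<bar> \<le> norm (X m - X n) * dist x y"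
          by (rule dist_apply_lipb_le)
        also have "\<dots> \<le> e * dist x y"
          using N[OF \<open>m \<ge> N\<close> n] by (intro mult_right_mono) auto
        finally show "\<bar>(apply_lipb (X m) x - apply_lipb (X n) x)
          - (apply_lipb (X m) y - apply_lipb (X n) y)\<bar> \<le> e * dist x y"
          by (simp add: minus_lipb.rep_eq)
      qed
    qed
    ultimately show ?thesis by blast
  qed
  obtain N where "\<forall>n\<ge>N. (\<forall>x. \<bar>f x - apply_lipb (X n) x\<bar> \<le> 1) \<and>
      (\<forall>x y. \<bar>(f x - apply_lipb (X n) x) - (f y - apply_lipb (X n) y)\<bar> \<le> 1 * dist x y)"
    using lim[OF zero_less_one] by blast
  hence "(\<lambda>x. f x - apply_lipb (X N) x) \<in> Lip_b"
    by (intro Lip_bI[of _ 1 1]) auto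
  from Lip_b_add[OF this apply_lipb_in_Lip_b[of "X N"]] have "f \<in> Lip_b" by simp
  then obtain F where F: "apply_lipb F = f" by (metis Abs_lipb_inverse)
  have "X \<longlonglongrightarrow> F"
  proof (rule LIMSEQ_I)
    fix e :: real assume e: "0 < e"
    obtain N where N: "\<forall>n\<ge>N. (\<forall>x. \<bar>f x - apply_lipb (X n) x\<bar> \<le> e/3) \<and>
      (\<forall>x y. \<bar>(f x - apply_lipb (X n) x) - (f y - apply_lipb (X n) y)\<bar> \<le> e/3 * dist x y)"
      using lim[of "e/3"] e by auto
    have "norm (X n - F) < e" if "n \<ge> N" for n
    proof -
      have "norm (F - X n) \<le> e/3 + e/3"
        using N that e by (intro norm_lipb_le) (auto simp: minus_lipb.rep_eq F)
      thus ?thesis using e by (simp add: norm_minus_commute)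
    qed
    thus "\<exists>no. \<forall>n\<ge>no. norm (X n - F) < e" by blast
  qed
  thus "convergent X" by (auto simp: convergent_def)
qed

lemma bounded_linear_apply_lipb: "bounded_linear (\<lambda>f. apply_lipb f x)"
  by (rule bounded_linear_intro[where K = 1])
     (auto simp: plus_lipb.rep_eq scaleR_lipb.rep_eq abs_apply_lipb_le)

lemma apply_lipb_power: "apply_lipb (f ^ n) x = apply_lipb f x ^ n"
  by (induction n) (simp_all add: one_lipb.rep_eq times_lipb.rep_eq)

text \<open>Evaluation at a point is a continuous algebra homomorphism, so it commutes with the
  exponential series.\<close>

lemma apply_lipb_exp: "apply_lipb (exp f) x = exp (apply_lipb f x)"
proof -
  have "(\<lambda>n. apply_lipb (f ^ n /\<^sub>R fact n) x) sums apply_lipb (exp f) x"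
    by (rule bounded_linear.sums[OF bounded_linear_apply_lipb exp_converges])
  hence "(\<lambda>n. apply_lipb f x ^ n /\<^sub>R fact n) sums apply_lipb (exp f) x"
    by (simp add: scaleR_lipb.rep_eq apply_lipb_power)
  thus ?thesis using sums_unique2 exp_converges by blast
qed

lemma Lip_b_ln:
  assumes f: "f \<in> Lip_b" and "0 < m" and m: "\<And>x. m \<le> f x"
  shows "(\<lambda>x. ln (f x)) \<in> Lip_b"
proof (rule Lip_bI)
  have lnd: "ln a - ln b \<le> \<bar>a - b\<bar> / m" if "m \<le> a" "m \<le> b" for a b
  proof -
    have "ln a - ln b = ln (a / b)" using that \<open>0 < m\<close> by (simp add: ln_div)
    also have "\<dots> \<le> a / b - 1" using that \<open>0 < m\<close> by (intro ln_le_minus_one) auto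
    also have "\<dots> = (a - b) / b" using that \<open>0 < m\<close> by (simp add: field_simps)
    also have "\<dots> \<le> \<bar>a - b\<bar> / b" using that \<open>0 < m\<close> by (intro divide_right_mono) auto
    also have "\<dots> \<le> \<bar>a - b\<bar> / m" using that \<open>0 < m\<close> by (intro divide_left_mono) auto
    finally show ?thesis .
  qed
  have lnd': "\<bar>ln a - ln b\<bar> \<le> \<bar>a - b\<bar> / m" if "m \<le> a" "m \<le> b" for a b
    using lnd[of a b] lnd[of b a] that by (simp add: abs_minus_commute abs_le_iff)
  show "\<bar>ln (f x)\<bar> \<le> \<bar>ln m\<bar> + (sup_abs f + m) / m" for x
  proof -
    have "\<bar>ln (f x) - ln m\<bar> \<le> \<bar>f x - m\<bar> / m" using lnd'[of "f x" m] m by simp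
    also have "\<dots> \<le> (sup_abs f + m) / m"
      using abs_le_sup_abs[OF f, of x] \<open>0 < m\<close> by (intro divide_right_mono) auto
    finally show ?thesis by linarith
  qed
  show "0 \<le> lip_const f / m" using lip_const_nonneg[OF f] \<open>0 < m\<close> by simp
  show "\<bar>ln (f x) - ln (f y)\<bar> \<le> lip_const f / m * dist x y" for x y
  proof -
    have "\<bar>f x - f y\<bar> \<le> lip_const f * dist x y"
      using lipschitz_onD[OF lipschitz_on_lip_const[OF f]] by (auto simp: dist_real_def)
    hence "\<bar>f x - f y\<bar> / m \<le> lip_const f * dist x y / m"
      using \<open>0 < m\<close> by (intro divide_right_mono) auto
    thus ?thesis using lnd'[of "f x" "f y"] m by simp
  qed
qed

lemma Lip_b_exp:
  assumes "f \<in> Lip_b"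
  shows "(\<lambda>x. exp (f x)) \<in> Lip_b"
proof -
  have "(\<lambda>x. exp (f x)) = apply_lipb (exp (Abs_lipb f))"
    by (simp add: fun_eq_iff apply_lipb_exp Abs_lipb_inverse assms)
  thus ?thesis by simp
qed

lemma Lip_b_powr:
  assumes "f \<in> Lip_b" "0 < m" "\<And>x. m \<le> f x"
  shows "(\<lambda>x. f x powr q) \<in> Lip_b"
proof -
  have "f x \<noteq> 0" for x using assms(2,3) by (smt (verit))
  hence "(\<lambda>x. f x powr q) = (\<lambda>x. exp (q * ln (f x)))" by (auto simp: powr_def)
  thus ?thesis using Lip_b_exp[OF Lip_b_scale[OF Lip_b_ln[OF assms]]] by simp
qed

section \<open>Slopes in length spaces\<close>

text \<open>A nearly shortest curve from \<open>x\<close> to \<open>z\<close> crosses every sphere about \<open>z\<close> of radius at most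
  \<open>dist x z\<close>, and at the crossing point the triangle inequality is nearly an equality. Such points
  stand in for points on a geodesic.\<close>

lemma length_space_approach:
  fixes x z :: "'a::metric_space"
  assumes len: "length_space TYPE('a)" and rho: "0 \<le> \<rho>" "\<rho> \<le> dist x z" and e: "0 < e"
  obtains z' where "dist z z' = \<rho>" "dist x z' \<le> dist x z - \<rho> + e"
proof -
  have "(INF \<gamma>\<in>{\<gamma>. path \<gamma> \<and> pathstart \<gamma> = x \<and> pathfinish \<gamma> = z}. curve_length \<gamma>)
      < ennreal (dist x z + e)"
  proof -
    have "ennreal (dist x z) < ennreal (dist x z + e)"
      using e by (intro ennreal_lessI) (auto simp: add_nonneg_pos)
    thus ?thesis using len unfolding length_space_def by metis
  qed
  then obtain \<gamma> where g: "path \<gamma>" "\<gamma> 0 = x" "\<gamma> 1 = z" and short: "curve_length \<gamma> < ennreal (dist x z + e)"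
    by (auto simp: INF_less_iff pathstart_def pathfinish_def)
  have "continuous_on {0..1} (\<lambda>t. dist z (\<gamma> t))"
    using g(1) unfolding path_def by (intro continuous_intros)
  then obtain t where t: "0 \<le> t" "t \<le> 1" "dist z (\<gamma> t) = \<rho>"
    using IVT2'[of "\<lambda>t. dist z (\<gamma> t)" 1 \<rho> 0] g rho by (auto simp: dist_commute)
  have "(\<Sum>i<length [0, t, 1] - 1. ennreal (dist (\<gamma> ([0, t, 1] ! i)) (\<gamma> ([0, t, 1] ! Suc i))))
      \<le> curve_length \<gamma>"
    unfolding curve_length_def using t by (intro SUP_upper) auto
  hence "ennreal (dist x (\<gamma> t) + dist (\<gamma> t) z) \<le> curve_length \<gamma>"
    using g by (simp add: numeral_2_eq_2 lessThan_Suc add.commute)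
  from le_less_trans[OF this short]
  have "dist x (\<gamma> t) + dist (\<gamma> t) z < dist x z + e"
    by (subst (asm) ennreal_less_iff) auto
  thus ?thesis using that[of "\<gamma> t"] t by (simp add: dist_commute)
qed

lemma grad_len_leI:
  assumes "0 < r" and bound: "\<And>y. 0 < dist x y \<Longrightarrow> dist x y < r \<Longrightarrow> \<bar>f x - f y\<bar> \<le> K * dist x y"
  shows "grad_len f x \<le> ennreal K"
proof (rule tendsto_upperbound[OF grad_len_tendsto])
  have "(SUP y\<in>{y. 0 < dist x y \<and> dist x y \<le> r'}. ennreal (\<bar>f x - f y\<bar> / dist x y)) \<le> ennreal K"
    if "r' < r" for r'
    using bound that by (intro SUP_least ennreal_leI) (auto simp: divide_simps)
  thus "\<forall>\<^sub>F r in at_right 0.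
      (SUP y\<in>{y. 0 < dist x y \<and> dist x y \<le> r}. ennreal (\<bar>f x - f y\<bar> / dist x y)) \<le> ennreal K"
    using \<open>0 < r\<close> by (auto simp: eventually_at_right_field intro!: exI[of _ r])
qed simp

lemma grad_len_lessD:
  assumes "grad_len f x < ennreal K" "0 \<le> K"
  obtains r where "0 < r" "\<And>y. dist x y \<le> r \<Longrightarrow> \<bar>f x - f y\<bar> \<le> K * dist x y"
proof -
  obtain r where r: "0 < r"
    "(SUP y\<in>{y. 0 < dist x y \<and> dist x y \<le> r}. ennreal (\<bar>f x - f y\<bar> / dist x y)) < ennreal K"
  proof -
    obtain b where b: "0 < b" "\<And>r. 0 < r \<Longrightarrow> r < b \<Longrightarrow>
        (SUP y\<in>{y. 0 < dist x y \<and> dist x y \<le> r}. ennreal (\<bar>f x - f y\<bar> / dist x y)) < ennreal K"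
      using order_tendstoD(2)[OF grad_len_tendsto assms(1)]
      unfolding eventually_at_right_field by blast
    show thesis by (rule that[of "b / 2"]) (use b(1) in simp, rule b(2), use b(1) in auto)
  qed
  have "\<bar>f x - f y\<bar> \<le> K * dist x y" if y: "dist x y \<le> r" for y
  proof (cases "x = y")
    case False
    have "ennreal (\<bar>f x - f y\<bar> / dist x y) < ennreal K"
      using y False by (intro le_less_trans[OF SUP_upper r(2)]) auto
    thus ?thesis using False assms(2) by (auto simp: ennreal_less_iff divide_simps split: if_splits)
  qed simp
  thus ?thesis using that r(1) by blast
qed

text \<open>If \<open>f\<close> descends towards \<open>x\<close> at least as fast as \<open>k * dist x\<close> does, then its slope is at least \<open>k\<close>,
  because the distance from \<open>x\<close> itself has descending slope \<open>1\<close> in a length space. This is how the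
  maximum principle is applied: at a maximum of \<open>f - w\<close>, where \<open>w\<close> depends only on the distance
  from \<open>x\<close>, the function \<open>f\<close> descends at least as fast as \<open>w\<close>.\<close>

lemma grad_len_ge_descent:
  fixes x z :: "'a::metric_space"
  assumes len: "length_space TYPE('a)" and "x \<noteq> z" "0 \<le> k"
    and descent: "\<And>e. 0 < e \<Longrightarrow> \<exists>\<delta>>0. \<forall>z'. dist z z' < \<delta> \<longrightarrow> dist x z' \<le> dist x z \<longrightarrow>
        (k - e) * (dist x z - dist x z') \<le> f z - f z'"
  shows "ennreal k \<le> grad_len f z"
proof (rule tendsto_lowerbound[OF grad_len_tendsto])
  have "ennreal k \<le> (SUP y\<in>{y. 0 < dist z y \<and> dist z y \<le> r}. ennreal (\<bar>f z - f y\<bar> / dist z y))"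
    if "0 < r" for r
  proof (rule ennreal_le_epsilon)
    fix e :: real assume e: "0 < e"
    define e' where "e' = min e 1 / 2"
    have e': "0 < e'" "e' < 1" "2 * e' \<le> e" using e by (auto simp: e'_def)
    obtain \<delta> where "0 < \<delta>" and
      \<delta>: "\<And>z'. dist z z' < \<delta> \<Longrightarrow> dist x z' \<le> dist x z \<Longrightarrow>
        (k - e') * (dist x z - dist x z') \<le> f z - f z'"
      using descent[OF e'(1)] by blast
    define \<rho> where "\<rho> = min r (min (\<delta> / 2) (dist x z))"
    have rho: "0 < \<rho>" "\<rho> \<le> r" "\<rho> < \<delta>" "\<rho> \<le> dist x z"
      using that assms(2) \<open>0 < \<delta>\<close> by (auto simp: \<rho>_def min_def)
    define \<eta> where "\<eta> = e' / (k + 1)"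
    have eta: "0 < \<eta>" "\<eta> \<le> 1" "k * \<eta> \<le> e'"
      using e' \<open>0 \<le> k\<close> by (auto simp: \<eta>_def field_simps)
    obtain z' where z': "dist z z' = \<rho>" "dist x z' \<le> dist x z - \<rho> + \<eta> * \<rho>"
      using length_space_approach[OF len, of \<rho> x z "\<eta> * \<rho>"] rho eta by auto
    have "\<eta> * \<rho> \<le> 1 * \<rho>" using eta rho by (intro mult_right_mono) auto
    hence closer: "dist x z' \<le> dist x z" using z' by simp
    have "dist x z - dist x z' \<le> \<rho>" using z'(1) by (metis dist_triangle3 dist_commute diff_le_eq)
    hence "e' * (dist x z - dist x z') \<le> e' * \<rho>" using e' by (intro mult_left_mono) auto
    moreover have "k * (\<rho> - \<eta> * \<rho>) \<le> k * (dist x z - dist x z')"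
      using z' \<open>0 \<le> k\<close> by (intro mult_left_mono) auto
    moreover have "(k - e') * (dist x z - dist x z') \<le> f z - f z'"
      using \<delta> z' rho closer by simp
    moreover have "k * \<eta> * \<rho> \<le> e' * \<rho>" using eta rho by (intro mult_right_mono) auto
    ultimately have "(k - 2 * e') * \<rho> \<le> \<bar>f z - f z'\<bar>"
      by (simp add: algebra_simps)
    hence "k - 2 * e' \<le> \<bar>f z - f z'\<bar> / \<rho>" using rho(1) by (simp add: field_simps)
    hence "k \<le> \<bar>f z - f z'\<bar> / \<rho> + e" using e' by simp
    hence "ennreal k \<le> ennreal (\<bar>f z - f z'\<bar> / \<rho>) + ennreal e"
      using rho(1) e by (subst ennreal_plus[symmetric]) (auto intro: ennreal_leI simp del: ennreal_plus)
    also have "\<dots> \<le> (SUP y\<in>{y. 0 < dist z y \<and> dist z y \<le> r}. ennreal (\<bar>f z - f y\<bar> / dist z y)) + ennreal e"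
      using z' rho by (intro add_right_mono SUP_upper2[of z']) auto
    finally show "ennreal k \<le> (SUP y\<in>{y. 0 < dist z y \<and> dist z y \<le> r}.
        ennreal (\<bar>f z - f y\<bar> / dist z y)) + ennreal e" .
  qed
  thus "\<forall>\<^sub>F r in at_right 0.
      ennreal k \<le> (SUP y\<in>{y. 0 < dist z y \<and> dist z y \<le> r}. ennreal (\<bar>f z - f y\<bar> / dist z y))"
    by (auto simp: eventually_at_right_field intro!: exI[of _ 1])
qed simp

lemma isCont_if_grad_len_le:
  assumes "grad_len f x \<le> ennreal K" "0 \<le> K"
  shows "isCont f x"
proof -
  have "grad_len f x < ennreal (K + 1)"
    using assms by (simp add: ennreal_lessI le_less_trans)
  then obtain r where r: "0 < r" "\<And>y. dist x y \<le> r \<Longrightarrow> \<bar>f x - f y\<bar> \<le> (K + 1) * dist x y"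
    using grad_len_lessD[of f x "K + 1"] assms by auto
  have "((\<lambda>y. f y - f x) \<longlongrightarrow> 0) (at x)"
  proof (rule Lim_null_comparison)
    show "\<forall>\<^sub>F y in at x. norm (f y - f x) \<le> (K + 1) * dist x y"
      unfolding eventually_at using r
      by (intro exI[of _ r]) (auto simp: dist_commute abs_minus_commute)
    have "((\<lambda>y. (K + 1) * dist x y) \<longlongrightarrow> (K + 1) * dist x x) (at x)" by (intro tendsto_intros)
    thus "((\<lambda>y. (K + 1) * dist x y) \<longlongrightarrow> 0) (at x)" by simp
  qed
  thus ?thesis unfolding isCont_def using LIM_zero_iff by blast
qed

text \<open>For \<open>K' > K\<close>, the difference of \<open>f\<close> and the cone \<open>K' * dist x\<close> attains its maximum because
  balls are compact. Away from the apex \<open>x\<close> a maximum would force a slope of at least \<open>K'\<close>, so the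
  maximum is at \<open>x\<close>.\<close>

lemma lipschitz_if_grad_len_le:
  fixes f :: "'a::heine_borel \<Rightarrow> real"
  assumes len: "length_space TYPE('a)" and "0 \<le> K"
    and slope: "\<And>x. grad_len f x \<le> ennreal K"
    and bdd: "\<And>x. \<bar>f x\<bar> \<le> B"
  shows "\<bar>f x - f y\<bar> \<le> K * dist x y"
proof -
  have cont: "continuous_on UNIV f"
    using isCont_if_grad_len_le[OF slope \<open>0 \<le> K\<close>] by (simp add: continuous_on_eq_continuous_at)
  have le: "f z - f x \<le> K * dist x z" for x z
  proof (rule field_le_epsilon)
    fix e :: real assume e: "0 < e"
    define K' where "K' = K + e / (dist x z + 1)"
    have K': "K < K'" using e by (simp add: K'_def add_nonneg_pos)
    hence "0 < K'" using \<open>0 \<le> K\<close> by simp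
    define h where "h w = f w - K' * dist x w" for w
    \<comment> \<open>Outside this radius \<open>h\<close> stays below its value at \<open>x\<close>.\<close>
    define R where "R = 2 * B / K'"
    have "0 \<le> B" using bdd[of x] by linarith
    have "0 \<le> R" using \<open>0 \<le> B\<close> \<open>0 < K'\<close> by (simp add: R_def)
    obtain w where w: "w \<in> cball x R" "\<And>v. v \<in> cball x R \<Longrightarrow> h v \<le> h w"
    proof -
      have "continuous_on (cball x R) h" unfolding h_def
        by (intro continuous_intros continuous_on_subset[OF cont]) auto
      thus ?thesis using continuous_attains_sup[of "cball x R" h] \<open>0 \<le> R\<close> that
        by (auto simp: mem_cball)
    qed
    have max: "h v \<le> h w" for v
    proof (cases "v \<in> cball x R")
      case False
      hence "2 * B \<le> K' * dist x v" using \<open>0 < K'\<close> by (auto simp: R_def field_simps)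
      hence "h v \<le> h x" using bdd[of v] bdd[of x] by (simp add: h_def)
      also have "\<dots> \<le> h w" using w(2) \<open>0 \<le> R\<close> by simp
      finally show ?thesis .
    qed (rule w(2))
    have "w = x"
    proof (rule ccontr)
      assume "w \<noteq> x"
      have le: "K' * (dist x w - dist x v) \<le> f w - f v" for v
        using max[of v] by (simp add: h_def algebra_simps)
      have "ennreal K' \<le> grad_len f w"
      proof (intro grad_len_ge_descent[OF len, of x w K'])
        fix e :: real assume "0 < e"
        have "(K' - e) * (dist x w - dist x v) \<le> K' * (dist x w - dist x v)"
          if "dist x v \<le> dist x w" for v
          using that \<open>0 < e\<close> by (intro mult_right_mono) auto
        hence "(K' - e) * (dist x w - dist x v) \<le> f w - f v" if "dist x v \<le> dist x w" for v
          using le[of v] that by (blast intro: order_trans)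
        thus "\<exists>\<delta>>0. \<forall>v. dist w v < \<delta> \<longrightarrow> dist x v \<le> dist x w \<longrightarrow>
            (K' - e) * (dist x w - dist x v) \<le> f w - f v"
          by (intro exI[of _ 1]) auto
      qed (use \<open>w \<noteq> x\<close> \<open>0 < K'\<close> in auto)
      with slope[of w] have "ennreal K' \<le> ennreal K" by (rule order_trans[rotated])
      thus False using K' \<open>0 \<le> K\<close> by simp
    qed
    with max[of z] have "f z - f x \<le> K' * dist x z" by (simp add: h_def)
    also have "\<dots> = K * dist x z + e * (dist x z / (dist x z + 1))"
      by (simp add: K'_def algebra_simps)
    also have "\<dots> \<le> K * dist x z + e * 1"
      using e by (intro add_left_mono mult_left_mono) (auto simp: divide_le_eq_1 add_nonneg_pos)
    finally show "f z - f x \<le> K * dist x z + e" by simp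
  qed
  show ?thesis using le[of x y] le[of y x] by (simp add: dist_commute abs_le_iff)
qed

section \<open>From the reverse logarithmic Sobolev inequality to entropic transport\<close>

lemma Lip_b_measurable:
  assumes "f \<in> Lip_b"
  shows "f \<in> borel_measurable borel"
proof (rule borel_measurable_continuous_onI)
  show "continuous_on UNIV f"
    using lipschitz_on_continuous_on[OF lipschitz_on_lip_const[OF assms]] .
qed

locale probability_kernel =
  fixes P :: "'a::metric_space \<Rightarrow> 'a measure"
  assumes markov: "markov_kernel P"
begin

lemma measurable_kernel: "P \<in> borel \<rightarrow>\<^sub>M subprob_algebra borel"
  using markov unfolding markov_kernel_def by (rule measurable_prob_algebraD)

lemma prob_kernel: "prob_space (P x)" and sets_kernel: "sets (P x) = sets borel"
  using measurable_space[OF markov[unfolded markov_kernel_def], of x]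
  by (simp_all add: space_prob_algebra)

lemma integrable_kernel:
  fixes f :: "'a \<Rightarrow> real"
  assumes "f \<in> borel_measurable borel" "\<And>y. \<bar>f y\<bar> \<le> B"
  shows "integrable (P x) f"
proof -
  interpret prob_space "P x" by (rule prob_kernel)
  show ?thesis
    using assms by (intro integrable_const_bound[where B = B])
      (auto simp: measurable_cong_sets[OF sets_kernel refl])
qed

lemma integrable_Lip_b: "f \<in> Lip_b \<Longrightarrow> integrable (P x) f"
  by (rule integrable_kernel[OF Lip_b_measurable abs_le_sup_abs])

lemma kernel_app_const [simp]: "kernel_app P (\<lambda>_. c) x = c"
proof -
  interpret prob_space "P x" by (rule prob_kernel)
  show ?thesis by (simp add: kernel_app_def prob_space)
qed

lemma kernel_app_add:
  assumes "integrable (P x) f" "integrable (P x) g"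
  shows "kernel_app P (\<lambda>y. f y + g y) x = kernel_app P f x + kernel_app P g x"
  using assms by (simp add: kernel_app_def)

lemma kernel_app_scale: "kernel_app P (\<lambda>y. c * f y) x = c * kernel_app P f x"
  by (simp add: kernel_app_def)

lemma kernel_app_mono:
  assumes "integrable (P x) f" "integrable (P x) g" "\<And>y. f y \<le> g y"
  shows "kernel_app P f x \<le> kernel_app P g x"
  unfolding kernel_app_def using assms by (rule integral_mono)

lemma kernel_app_ge: "integrable (P x) f \<Longrightarrow> (\<And>y. m \<le> f y) \<Longrightarrow> m \<le> kernel_app P f x"
  using kernel_app_mono[of x "\<lambda>_. m" f] prob_kernel[of x]
  by (simp add: finite_measure.integrable_const prob_space.finite_measure)

lemma kernel_app_le: "integrable (P x) f \<Longrightarrow> (\<And>y. f y \<le> M) \<Longrightarrow> kernel_app P f x \<le> M"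
  using kernel_app_mono[of x f "\<lambda>_. M"] prob_kernel[of x]
  by (simp add: finite_measure.integrable_const prob_space.finite_measure)

lemma kernel_app_pos:
  assumes "integrable (P x) f" "\<And>y. 0 < f y"
  shows "0 < kernel_app P f x"
proof -
  interpret prob_space "P x" by (rule prob_kernel)
  have "kernel_app P f x \<noteq> 0"
  proof
    assume "kernel_app P f x = 0"
    hence "AE y in P x. f y = 0"
      using assms integral_nonneg_eq_0_iff_AE[of "P x" f] by (simp add: kernel_app_def less_imp_le)
    hence "AE y in P x. False" by eventually_elim (use assms(2) in \<open>metis less_irrefl\<close>)
    thus False by simp
  qed
  moreover have "0 \<le> kernel_app P f x" using assms by (intro kernel_app_ge) (auto intro: less_imp_le)
  ultimately show ?thesis by simp
qed

lemma integral_bind_kernel: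
  assumes "f \<in> Lip_b" "\<mu> \<in> prob_measures"
  shows "(\<integral>y. f y \<partial>(\<mu> \<bind> P)) = (\<integral>x. kernel_app P f x \<partial>\<mu>)"
  unfolding kernel_app_def
proof (rule integral_bind[where K = borel and B = "sup_abs f" and B' = 1])
  have \<mu>: "prob_space \<mu>" "sets \<mu> = sets borel"
    using assms(2) by (auto simp: space_prob_algebra)
  show "finite_measure \<mu>" using \<mu>(1) by (rule prob_space.finite_measure)
  show "P \<in> \<mu> \<rightarrow>\<^sub>M subprob_algebra borel"
    using measurable_kernel measurable_cong_sets[OF \<mu>(2) refl] by blast
  show "AE x in \<mu>. emeasure (P x) (space (P x)) \<le> ennreal 1"
    using prob_kernel by (simp add: prob_space.emeasure_space_1)
qed (use assms in \<open>auto intro: Lip_b_measurable abs_le_sup_abs\<close>)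

lemma return_bind_kernel: "return borel x \<bind> P = P x"
  using bind_return[OF measurable_kernel] by simp

end

lemma E_classD:
  assumes "\<phi> \<in> E_class a b"
  obtains m M \<phi>' where "0 < m"
    "\<And>s x. s \<in> {0..1} \<Longrightarrow> m \<le> apply_lipb (\<phi> s) x \<and> apply_lipb (\<phi> s) x \<le> M"
    "continuous_on {0..1} \<phi>'"
    "\<And>s. s \<in> {0..1} \<Longrightarrow> (\<phi> has_vector_derivative \<phi>' s) (at s within {0..1})"
    "\<And>s x. s \<in> {0..1} \<Longrightarrow> ereal (apply_lipb (\<phi>' s) x)
        + ereal (a * apply_lipb (\<phi> s) x) * (enn2ereal (grad_len (\<lambda>z. ln (apply_lipb (\<phi> s) z)) x))\<^sup>2
        + ereal (b * (apply_lipb (\<phi> s) x * ln (apply_lipb (\<phi> s) x))) \<le> 0"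
  using assms unfolding E_class_def by blast

lemma enn2ereal_le_if_square_le:
  assumes "(enn2ereal g)\<^sup>2 \<le> ereal (c\<^sup>2)" "0 \<le> c"
  shows "g \<le> ennreal c"
proof (cases g)
  case (real r)
  thus ?thesis using assms by (auto intro!: ennreal_leI power2_le_imp_le)
next
  case top
  thus ?thesis using assms by simp
qed

locale reverse_log_sobolev_kernel = probability_kernel P
  for P :: "'a::heine_borel \<Rightarrow> 'a measure" +
  fixes C :: real
  assumes length_space: "length_space TYPE('a)" and C_pos: "0 < C"
    and rls: "reverse_log_sobolev P C"
begin

lemma rls_apply:
  assumes "f \<in> Lip_b" "\<And>x. 0 < f x"
  shows "ereal (kernel_app P f x) * (enn2ereal (grad_len (\<lambda>z. ln (kernel_app P f z)) x))\<^sup>2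
            \<le> ereal (C * (kernel_app P (\<lambda>y. f y * ln (f y)) x
                          - kernel_app P f x * ln (kernel_app P f x)))"
  using rls assms by (auto simp: reverse_log_sobolev_def)

text \<open>For functions with values near \<open>1\<close> the entropy on the right of the inequality is bounded, so the
  inequality bounds the slope of \<open>ln (P f)\<close> uniformly.\<close>

lemma kernel_app_lipschitz_near_one:
  assumes f: "f \<in> Lip_b" and range: "\<And>x. 1/2 \<le> f x" "\<And>x. f x \<le> 3/2"
  shows "\<bar>kernel_app P f x - kernel_app P f y\<bar> \<le> 3 * sqrt C * dist x y"
proof -
  have pos: "0 < f x" for x using range(1)[of x] by linarith
  have F: "1/2 \<le> kernel_app P f x" "kernel_app P f x \<le> 3/2" for x
    by (intro kernel_app_ge kernel_app_le integrable_Lip_b f range)+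
  have flnf: "(\<lambda>y. f y * ln (f y)) \<in> Lip_b"
    using Lip_b_mult[OF f Lip_b_ln[OF f _ range(1)]] by simp
  have slope: "grad_len (\<lambda>z. ln (kernel_app P f z)) x \<le> ennreal (2 * sqrt C)" for x
  proof (rule enn2ereal_le_if_square_le)
    let ?F = "kernel_app P f x" and ?G = "enn2ereal (grad_len (\<lambda>z. ln (kernel_app P f z)) x)"
    have "f y * ln (f y) \<le> 1" for y
    proof -
      have "f y * ln (f y) \<le> f y * (f y - 1)"
        using pos[of y] by (intro mult_left_mono ln_le_minus_one) auto
      also have "\<dots> \<le> 3/2 * (1/2)"
      proof (cases "f y \<le> 1")
        case True
        hence "f y * (f y - 1) \<le> 0" using pos[of y] by (intro mult_nonneg_nonpos) auto
        thus ?thesis by simp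
      next
        case False
        thus ?thesis using range(2)[of y] by (intro mult_mono) auto
      qed
      finally show ?thesis by simp
    qed
    \<comment> \<open>The two parts of the entropy are bounded by means of \<open>ln t \<le> t - 1\<close>.\<close>
    hence 1: "kernel_app P (\<lambda>y. f y * ln (f y)) x \<le> 1"
      by (intro kernel_app_le integrable_Lip_b flnf)
    have "- ln ?F = ln (1 / ?F)" using F(1)[of x] by (simp add: ln_div)
    also have "\<dots> \<le> 1 / ?F - 1" using F(1)[of x] by (intro ln_le_minus_one) auto
    finally have "?F * (- ln ?F) \<le> ?F * (1 / ?F - 1)"
      using F(1)[of x] by (intro mult_left_mono) auto
    also have "\<dots> = 1 - ?F" using F(1)[of x] by (simp add: field_simps)
    finally have 2: "- (?F * ln ?F) \<le> 1/2" using F(1)[of x] by simp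
    have "ereal (1/2) * ?G\<^sup>2 \<le> ereal ?F * ?G\<^sup>2"
      using F(1)[of x] by (intro ereal_mult_right_mono) (auto simp: power2_eq_square)
    also have "\<dots> \<le> ereal (C * (kernel_app P (\<lambda>y. f y * ln (f y)) x - ?F * ln ?F))"
      by (rule rls_apply[OF f pos])
    also have "\<dots> \<le> ereal (C * 2)"
      using 1 2 C_pos by (simp only: ereal_less_eq) (intro mult_left_mono, auto)
    finally have "ereal (1/2) * ?G\<^sup>2 \<le> ereal (C * 2)" .
    thus "?G\<^sup>2 \<le> ereal ((2 * sqrt C)\<^sup>2)"
      using C_pos by (cases "?G\<^sup>2") (auto simp: power_mult_distrib)
  qed (use C_pos in simp)
  let ?l = "\<lambda>z. ln (kernel_app P f z)"
  have lip: "\<bar>?l x - ?l y\<bar> \<le> 2 * sqrt C * dist x y" for x y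
  proof (rule lipschitz_if_grad_len_le[OF length_space _ slope])
    show "\<bar>?l z\<bar> \<le> max \<bar>ln (1/2)\<bar> \<bar>ln (3/2)\<bar>" for z
    proof -
      have "ln (1/2) \<le> ?l z" "?l z \<le> ln (3/2)"
        using F[of z] by (auto intro!: ln_mono)
      thus ?thesis by linarith
    qed
  qed (use C_pos in simp)
  \<comment> \<open>Passing from \<open>ln a - ln b\<close> to \<open>a - b\<close> costs the upper bound \<open>3/2\<close>.\<close>
  have diff: "kernel_app P f x - kernel_app P f y \<le> 3 * sqrt C * dist x y" for x y
  proof -
    let ?a = "kernel_app P f x" and ?b = "kernel_app P f y"
    have "?l y - ?l x = ln (?b / ?a)" using F(1)[of x] F(1)[of y] by (simp add: ln_div)
    also have "\<dots> \<le> ?b / ?a - 1" using F(1)[of x] F(1)[of y] by (intro ln_le_minus_one) auto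
    finally have "1 - ?b / ?a \<le> 2 * sqrt C * dist x y" using lip[of x y] by linarith
    hence "?a * (1 - ?b / ?a) \<le> 3/2 * (2 * sqrt C * dist x y)"
      using F[of x] C_pos by (intro order_trans[OF mult_left_mono mult_right_mono]) auto
    thus ?thesis using F(1)[of x] by (simp add: right_diff_distrib)
  qed
  show ?thesis using diff[of x y] diff[of y x] by (simp add: dist_commute abs_le_iff)
qed

text \<open>The inequality is only available for positive functions, but \<open>g\<close> and the positive function
  \<open>1 + t g\<close> have the same oscillations up to the factor \<open>t\<close>.\<close>

lemma kernel_app_lipb_lipschitz:
  "\<bar>kernel_app P (apply_lipb g) x - kernel_app P (apply_lipb g) y\<bar> \<le> (6 * sqrt C * norm g) * dist x y"
proof (cases "g = 0")
  case True
  thus ?thesis by (simp add: zero_lipb.rep_eq)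
next
  case False
  define t where "t = 1 / (2 * norm g)"
  have t: "0 < t" "norm g = 1 / (2 * t)" using False by (simp_all add: t_def)
  have "\<bar>t * apply_lipb g z\<bar> \<le> t * norm g" for z
    using t(1) abs_apply_lipb_le[of g z] by (simp add: abs_mult)
  hence half: "\<bar>t * apply_lipb g z\<bar> \<le> 1/2" for z using False by (simp add: t_def)
  have "kernel_app P (\<lambda>z. 1 + t * apply_lipb g z) x = 1 + t * kernel_app P (apply_lipb g) x" for x
    by (subst kernel_app_add)
      (auto intro!: integrable_Lip_b Lip_b_const Lip_b_scale simp: kernel_app_scale)
  moreover have "\<bar>kernel_app P (\<lambda>z. 1 + t * apply_lipb g z) x
        - kernel_app P (\<lambda>z. 1 + t * apply_lipb g z) y\<bar> \<le> 3 * sqrt C * dist x y"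
  proof (rule kernel_app_lipschitz_near_one)
    show "1/2 \<le> 1 + t * apply_lipb g z" "1 + t * apply_lipb g z \<le> 3/2" for z
      using half[of z] by (simp_all add: abs_le_iff)
  qed (intro Lip_b_add Lip_b_const Lip_b_scale apply_lipb_in_Lip_b)
  ultimately have "\<bar>t * (kernel_app P (apply_lipb g) x - kernel_app P (apply_lipb g) y)\<bar>
      \<le> 3 * sqrt C * dist x y"
    by (simp add: algebra_simps)
  thus ?thesis using t(1) unfolding abs_mult by (simp add: t(2) field_simps)
qed

lemma kernel_app_Lip_b: "kernel_app P (apply_lipb g) \<in> Lip_b"
proof (rule Lip_bI)
  show "\<bar>kernel_app P (apply_lipb g) x\<bar> \<le> norm g" for x
    using abs_apply_lipb_le[of g] kernel_app_le[of x "apply_lipb g" "norm g"]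
      kernel_app_ge[of x "apply_lipb g" "- norm g"] integrable_Lip_b[of "apply_lipb g" x]
    by (simp add: abs_le_iff minus_le_iff)
  show "0 \<le> 6 * sqrt C * norm g" using C_pos by simp
qed (rule kernel_app_lipb_lipschitz)

text \<open>As a bounded operator on \<^typ>\<open>'a lipb\<close>, the kernel maps \<open>C\<^sup>1\<close> curves to \<open>C\<^sup>1\<close> curves.\<close>

definition kernel_op :: "'a lipb \<Rightarrow> 'a lipb" where
  "kernel_op g = Abs_lipb (kernel_app P (apply_lipb g))"

lemma apply_kernel_op: "apply_lipb (kernel_op g) = kernel_app P (apply_lipb g)"
  by (simp add: kernel_op_def Abs_lipb_inverse kernel_app_Lip_b)

lemma bounded_linear_kernel_op: "bounded_linear kernel_op"
proof (rule bounded_linear_intro[where K = "1 + 6 * sqrt C"])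
  fix f g :: "'a lipb" and r :: real
  show "kernel_op (f + g) = kernel_op f + kernel_op g"
    by (simp add: apply_lipb_inject[symmetric] apply_kernel_op plus_lipb.rep_eq fun_eq_iff
        kernel_app_add integrable_Lip_b)
  show "kernel_op (r *\<^sub>R f) = r *\<^sub>R kernel_op f"
    by (simp add: apply_lipb_inject[symmetric] apply_kernel_op scaleR_lipb.rep_eq fun_eq_iff
        kernel_app_scale)
  have "norm (kernel_op f) \<le> norm f + 6 * sqrt C * norm f"
  proof (rule norm_lipb_le)
    show "\<bar>apply_lipb (kernel_op f) x\<bar> \<le> norm f" for x
      unfolding apply_kernel_op
      using abs_apply_lipb_le[of f] kernel_app_le[of x "apply_lipb f" "norm f"]
        kernel_app_ge[of x "apply_lipb f" "- norm f"] integrable_Lip_b[of "apply_lipb f" x]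
      by (simp add: abs_le_iff minus_le_iff)
  qed (use C_pos kernel_app_lipb_lipschitz in \<open>auto simp: apply_kernel_op\<close>)
  thus "norm (kernel_op f) \<le> norm f * (1 + 6 * sqrt C)" by (simp add: algebra_simps)
qed

text \<open>The slope term that \<open>E_class \<kappa> (\<kappa> * C)\<close> has and \<open>E_class 0 (\<kappa> * C)\<close> lacks is at most
  \<open>\<kappa> C (P (\<phi> ln \<phi>) - P \<phi> ln (P \<phi>))\<close> by the reverse logarithmic Sobolev inequality, that is,
  \<open>\<kappa> C\<close> times the error made when \<open>P\<close> is exchanged with \<open>t \<mapsto> t ln t\<close>.\<close>

lemma kernel_op_E_class:
  assumes \<phi>: "\<phi> \<in> E_class 0 (\<kappa> * C)" and "0 < \<kappa>"
  shows "(\<lambda>s. kernel_op (\<phi> s)) \<in> E_class \<kappa> (\<kappa> * C)"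
proof -
  from E_classD[OF \<phi>] obtain m M \<phi>' where m: "0 < m" and
    bounds: "\<And>s x. s \<in> {0..1} \<Longrightarrow> m \<le> apply_lipb (\<phi> s) x \<and> apply_lipb (\<phi> s) x \<le> M"
    and cont: "continuous_on {0..1} \<phi>'"
    and deriv: "\<And>s. s \<in> {0..1} \<Longrightarrow> (\<phi> has_vector_derivative \<phi>' s) (at s within {0..1})"
    and ineq_ereal: "\<And>s x. s \<in> {0..1} \<Longrightarrow> ereal (apply_lipb (\<phi>' s) x)
        + ereal (0 * apply_lipb (\<phi> s) x) * (enn2ereal (grad_len (\<lambda>z. ln (apply_lipb (\<phi> s) z)) x))\<^sup>2
        + ereal (\<kappa> * C * (apply_lipb (\<phi> s) x * ln (apply_lipb (\<phi> s) x))) \<le> 0"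
    by blast
  have ineq: "apply_lipb (\<phi>' s) x + \<kappa> * C * (apply_lipb (\<phi> s) x * ln (apply_lipb (\<phi> s) x)) \<le> 0"
    if "s \<in> {0..1}" for s x
    using ineq_ereal[OF that, of x] by (simp add: zero_ereal_def[symmetric])
  have "ereal (apply_lipb (kernel_op (\<phi>' s)) x)
      + ereal (\<kappa> * apply_lipb (kernel_op (\<phi> s)) x)
          * (enn2ereal (grad_len (\<lambda>z. ln (apply_lipb (kernel_op (\<phi> s)) z)) x))\<^sup>2
      + ereal (\<kappa> * C * (apply_lipb (kernel_op (\<phi> s)) x * ln (apply_lipb (kernel_op (\<phi> s)) x))) \<le> 0"
    (is "ereal ?d + ?g + ereal ?l \<le> 0") if s: "s \<in> {0..1}" for s x
  proof -
    let ?f = "apply_lipb (\<phi> s)"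
    let ?F = "kernel_app P ?f x" and ?H = "kernel_app P (\<lambda>y. ?f y * ln (?f y)) x"
    have f: "?f \<in> Lip_b" "\<And>y. 0 < ?f y"
      using bounds[OF s] m by (auto intro: less_le_trans)
    have flnf: "(\<lambda>y. ?f y * ln (?f y)) \<in> Lip_b"
      using Lip_b_mult[OF f(1) Lip_b_ln[OF f(1) m]] bounds[OF s] by simp
    have "?g = ereal \<kappa> * (ereal ?F * (enn2ereal (grad_len (\<lambda>z. ln (kernel_app P ?f z)) x))\<^sup>2)"
      by (simp add: apply_kernel_op mult.assoc flip: times_ereal.simps(1))
    also have "\<dots> \<le> ereal \<kappa> * ereal (C * (?H - ?F * ln ?F))"
      using rls_apply[OF f, of x] \<open>0 < \<kappa>\<close> by (intro ereal_mult_left_mono) auto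
    finally have g: "?g \<le> ereal (\<kappa> * C * (?H - ?F * ln ?F))" by (simp add: mult.assoc)
    have "ereal ?d + ?g + ereal ?l \<le> ereal ?d + ereal (\<kappa> * C * (?H - ?F * ln ?F)) + ereal ?l"
      by (intro add_mono g order_refl)
    also have "\<dots> = ereal (kernel_app P (apply_lipb (\<phi>' s)) x + \<kappa> * C * ?H)"
      by (simp add: apply_kernel_op algebra_simps)
    also have "kernel_app P (apply_lipb (\<phi>' s)) x + \<kappa> * C * ?H
        = kernel_app P (\<lambda>y. apply_lipb (\<phi>' s) y + \<kappa> * C * (?f y * ln (?f y))) x"
      by (subst kernel_app_add)
        (auto intro!: integrable_Lip_b Lip_b_scale flnf simp: kernel_app_scale)
    also have "\<dots> \<le> 0"
      using ineq[OF s] by (intro kernel_app_le integrable_Lip_b Lip_b_add Lip_b_scale[OF flnf]) auto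
    finally show ?thesis by (simp add: zero_ereal_def)
  qed
  moreover have "m \<le> apply_lipb (kernel_op (\<phi> s)) x \<and> apply_lipb (kernel_op (\<phi> s)) x \<le> M"
    if "s \<in> {0..1}" for s x
    unfolding apply_kernel_op using bounds[OF that]
    by (auto intro!: kernel_app_ge kernel_app_le integrable_Lip_b)
  moreover have "continuous_on {0..1} (\<lambda>s. kernel_op (\<phi>' s))"
    by (intro bounded_linear.continuous_on[OF bounded_linear_kernel_op] cont)
  moreover have "((\<lambda>s. kernel_op (\<phi> s)) has_vector_derivative kernel_op (\<phi>' s)) (at s within {0..1})"
    if "s \<in> {0..1}" for s
    by (intro bounded_linear.has_vector_derivative[OF bounded_linear_kernel_op] deriv that)
  ultimately show ?thesis
    unfolding E_class_def mem_Collect_eq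
    by (intro conjI exI[of _ m] exI[of _ M] exI[of _ "\<lambda>s. kernel_op (\<phi>' s)"] ballI allI m) auto
qed

lemma entropic_transport: "entropic_transport_ineq P C"
  unfolding entropic_transport_ineq_def
proof (intro ballI allI impI)
  fix \<mu>0 \<mu>1 :: "'a measure" and \<kappa> :: real
  assume \<mu>: "\<mu>0 \<in> prob_measures" "\<mu>1 \<in> prob_measures" and "0 < \<kappa>"
  show "T_cost 0 (\<kappa> * C) (\<mu>0 \<bind> P) (\<mu>1 \<bind> P) \<le> T_cost \<kappa> (\<kappa> * C) \<mu>0 \<mu>1"
    unfolding T_cost_def
  proof (rule SUP_mono)
    fix \<phi> :: "real \<Rightarrow> 'a lipb" assume "\<phi> \<in> E_class 0 (\<kappa> * C)"
    thus "\<exists>\<psi>\<in>E_class \<kappa> (\<kappa> * C).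
        ereal ((\<integral>x. apply_lipb (\<phi> 1) x \<partial>(\<mu>1 \<bind> P)) - (\<integral>x. apply_lipb (\<phi> 0) x \<partial>(\<mu>0 \<bind> P)))
        \<le> ereal ((\<integral>x. apply_lipb (\<psi> 1) x \<partial>\<mu>1) - (\<integral>x. apply_lipb (\<psi> 0) x \<partial>\<mu>0))"
      using \<mu> \<open>0 < \<kappa>\<close> kernel_op_E_class
      by (intro bexI[of _ "\<lambda>s. kernel_op (\<phi> s)"]) (auto simp: integral_bind_kernel apply_kernel_op)
  qed
qed

end

section \<open>A comparison principle for the Hamilton-Jacobi inequality\<close>

lemma continuous_on_apply_lipb_path:
  fixes \<phi> :: "real \<Rightarrow> 'a::metric_space lipb"
  assumes "continuous_on S \<phi>"
  shows "continuous_on (S \<times> UNIV) (\<lambda>p. apply_lipb (\<phi> (fst p)) (snd p))"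
  unfolding continuous_on_def
proof
  fix p0 :: "real \<times> 'a" assume "p0 \<in> S \<times> UNIV"
  then obtain s0 z0 where p0: "p0 = (s0, z0)" "s0 \<in> S" by auto
  let ?F = "at p0 within S \<times> UNIV"
  have "continuous_on (S \<times> (UNIV :: 'a set)) (\<lambda>p. \<phi> (fst p))"
    by (intro continuous_on_compose2[OF assms] continuous_intros) auto
  hence \<phi>: "((\<lambda>p. \<phi> (fst p)) \<longlongrightarrow> \<phi> s0) ?F"
    using p0 by (auto simp: continuous_on_def)
  have "((\<lambda>p. norm (\<phi> (fst p) - \<phi> s0) + norm (\<phi> s0) * dist (snd p) z0)
      \<longlongrightarrow> norm (\<phi> s0 - \<phi> s0) + norm (\<phi> s0) * dist (snd p0) z0) ?F"
    by (intro tendsto_intros \<phi>)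
  hence lim: "((\<lambda>p. norm (\<phi> (fst p) - \<phi> s0) + norm (\<phi> s0) * dist (snd p) z0) \<longlongrightarrow> 0) ?F"
    by (simp add: p0)
  have "((\<lambda>p. apply_lipb (\<phi> (fst p)) (snd p) - apply_lipb (\<phi> s0) z0) \<longlongrightarrow> 0) ?F"
  proof (rule Lim_null_comparison[OF always_eventually lim], rule allI)
    fix p :: "real \<times> 'a"
    have "\<bar>apply_lipb (\<phi> (fst p)) (snd p) - apply_lipb (\<phi> s0) (snd p)\<bar> \<le> norm (\<phi> (fst p) - \<phi> s0)"
      using abs_apply_lipb_le[of "\<phi> (fst p) - \<phi> s0" "snd p"] by (simp add: minus_lipb.rep_eq)
    moreover have "\<bar>apply_lipb (\<phi> s0) (snd p) - apply_lipb (\<phi> s0) z0\<bar> \<le> norm (\<phi> s0) * dist (snd p) z0"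
      by (rule dist_apply_lipb_le)
    ultimately show "norm (apply_lipb (\<phi> (fst p)) (snd p) - apply_lipb (\<phi> s0) z0)
        \<le> norm (\<phi> (fst p) - \<phi> s0) + norm (\<phi> s0) * dist (snd p) z0"
      by simp
  qed
  thus "((\<lambda>p. apply_lipb (\<phi> (fst p)) (snd p)) \<longlongrightarrow> apply_lipb (\<phi> (fst p0)) (snd p0)) ?F"
    by (simp add: p0 LIM_zero_iff)
qed

text \<open>Dividing the differential inequality by \<open>\<phi>\<close> turns it into a Hamilton-Jacobi inequality for
  \<open>v = ln \<phi>\<close>. The slope \<open>G\<close> may be replaced by any real lower bound \<open>k\<close>.\<close>

lemma E_class_slope_ineq:
  assumes ineq: "ereal d + ereal (a * c) * (enn2ereal G)\<^sup>2 + ereal (b * (c * v)) \<le> 0"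
    and k: "ennreal k \<le> G" "0 \<le> k" and "0 \<le> a" "0 < c"
  shows "d / c + b * v \<le> - (a * k\<^sup>2)"
proof -
  have "ereal (k\<^sup>2) \<le> (enn2ereal G)\<^sup>2"
  proof (cases G)
    case (real r)
    thus ?thesis using k by (auto intro!: power_mono)
  next
    case top
    thus ?thesis by simp
  qed
  hence "ereal (a * c) * ereal (k\<^sup>2) \<le> ereal (a * c) * (enn2ereal G)\<^sup>2"
    using assms by (intro ereal_mult_left_mono) auto
  hence "ereal d + ereal (a * c) * ereal (k\<^sup>2) + ereal (b * (c * v))
      \<le> ereal d + ereal (a * c) * (enn2ereal G)\<^sup>2 + ereal (b * (c * v))"
    by (intro add_mono) auto
  also note ineq
  finally have "d + a * c * k\<^sup>2 + b * (c * v) \<le> 0" by simp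
  hence "d + b * (c * v) \<le> - (a * k\<^sup>2) * c" by (simp add: algebra_simps)
  hence "(d + b * (c * v)) / c \<le> - (a * k\<^sup>2)" using \<open>0 < c\<close> by (simp add: divide_le_eq)
  thus ?thesis using \<open>0 < c\<close> by (simp add: add_divide_distrib)
qed

text \<open>For \<open>u\<^sub>s = exp (b s) ln \<phi>\<^sub>s\<close> the zeroth order term disappears, and
  \<open>\<partial>\<^sub>s u + \<tau>' \<bar>\<nabla>u\<bar>\<^sup>2 \<le> 0\<close> with the new time \<open>\<tau> s = (1 - exp (- b s)) / C\<close>. Hence \<open>u\<close> lies below the
  Hopf-Lax solution that starts from the value \<open>u\<^sub>0 y\<close> at \<open>y\<close> and from infinity elsewhere, namely
  \<open>u\<^sub>0 y + d(y, z)\<^sup>2 / (4 \<tau> s)\<close>. The comparison is a maximum principle: wherever the difference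
  attains its maximum, \<open>u\<close> has at least the slope of the Hopf-Lax solution, hence a strictly
  smaller time derivative once the solution is perturbed by \<open>\<theta> s\<close>. Compact balls provide the maximum
  and the length structure provides the slope.\<close>

lemma hamilton_jacobi_bound:
  fixes x y :: "'a::heine_borel"
  assumes len: "length_space TYPE('a)" and "0 < C" "0 < \<kappa>"
    and \<phi>: "\<phi> \<in> E_class \<kappa> (\<kappa> * C)"
  defines "b \<equiv> \<kappa> * C"
  shows "exp b * ln (apply_lipb (\<phi> 1) x)
    \<le> ln (apply_lipb (\<phi> 0) y) + C * (dist x y)\<^sup>2 / (4 * (1 - exp (- b)))"
proof -
  have b: "0 < b" using assms by simp
  from E_classD[OF \<phi>[folded b_def]] obtain m M \<phi>' where m: "0 < m" and
    bounds: "\<And>s x. s \<in> {0..1} \<Longrightarrow> m \<le> apply_lipb (\<phi> s) x \<and> apply_lipb (\<phi> s) x \<le> M"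
    and deriv: "\<And>s. s \<in> {0..1} \<Longrightarrow> (\<phi> has_vector_derivative \<phi>' s) (at s within {0..1})"
    and ineq: "\<And>s x. s \<in> {0..1} \<Longrightarrow> ereal (apply_lipb (\<phi>' s) x)
        + ereal (\<kappa> * apply_lipb (\<phi> s) x) * (enn2ereal (grad_len (\<lambda>z. ln (apply_lipb (\<phi> s) z)) x))\<^sup>2
        + ereal (b * (apply_lipb (\<phi> s) x * ln (apply_lipb (\<phi> s) x))) \<le> 0"
    by metis
  define v where "v s z = ln (apply_lipb (\<phi> s) z)" for s z
  define u where "u s z = exp (b * s) * v s z" for s z
  define \<tau> where "\<tau> s = (1 - exp (- b * s)) / C" for s
  have pos: "0 < apply_lipb (\<phi> s) z" if "s \<in> {0..1}" for s z
    using bounds[OF that, of z] m by linarith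
  have tau: "0 \<le> \<tau> s" "\<tau> s \<le> 1 / C" if "s \<in> {0..1}" for s
    using that b \<open>0 < C\<close> by (auto simp: \<tau>_def divide_right_mono)
  have "0 < \<tau> 1" using b \<open>0 < C\<close> by (simp add: \<tau>_def)
  have v0: "v 0 \<in> Lip_b"
    unfolding v_def using bounds[of 0] by (intro Lip_b_ln[OF _ m]) auto
  define L where "L = lip_const (v 0)"
  have L: "v 0 z - v 0 w \<le> L * dist w z" for z w
    using lipschitz_onD[OF lipschitz_on_lip_const[OF v0], of z w]
    by (auto simp: dist_real_def L_def dist_commute)
  define U where "U = exp b * max \<bar>ln m\<bar> \<bar>ln M\<bar>"
  have U: "\<bar>u s z\<bar> \<le> U" if "s \<in> {0..1}" for s z
  proof -
    have "ln m \<le> v s z" "v s z \<le> ln M"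
      unfolding v_def using bounds[OF that, of z] m by (auto intro!: ln_mono)
    hence "\<bar>v s z\<bar> \<le> max \<bar>ln m\<bar> \<bar>ln M\<bar>" by linarith
    moreover have "exp (b * s) \<le> exp b" using that b by simp
    ultimately show ?thesis unfolding u_def U_def abs_mult by (intro mult_mono) auto
  qed
  have "0 \<le> U" by (simp add: U_def)
  have \<phi>_cont: "continuous_on {0..1} \<phi>"
    unfolding continuous_on_eq_continuous_within
    using deriv has_vector_derivative_continuous by blast
  have u_cont: "continuous_on ({0..1} \<times> UNIV) (\<lambda>p. u (fst p) (snd p))"
  proof -
    have "continuous_on ({0..1} \<times> UNIV) (\<lambda>p. apply_lipb (\<phi> (fst p)) (snd p))"
      by (rule continuous_on_apply_lipb_path[OF \<phi>_cont])
    moreover have "apply_lipb (\<phi> (fst p)) (snd p) \<noteq> 0" if "p \<in> {0..1} \<times> UNIV" for p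
      using pos[of "fst p" "snd p"] that by auto
    ultimately show ?thesis
      unfolding u_def v_def by (intro continuous_intros) auto
  qed
  have key: "u 1 x \<le> u 0 y + (dist y x)\<^sup>2 / (4 * (\<tau> 1 + \<theta>)) + (L\<^sup>2 + 1) * \<theta>" if "0 < \<theta>" for \<theta>
  proof (rule ccontr)
    assume contra: "\<not> ?thesis"
    \<comment> \<open>The shift by \<open>\<theta>\<close> removes the singularity of the Hopf-Lax solution at time \<open>0\<close>, at the cost of the
      initial error \<open>L\<^sup>2 \<theta>\<close>.\<close>
    define F where "F s z = u s z - (dist y z)\<^sup>2 / (4 * (\<tau> s + \<theta>)) - \<theta> * s" for s z
    have T_pos: "0 < \<tau> s + \<theta>" if "s \<in> {0..1}" for s using tau[OF that] \<open>0 < \<theta>\<close> by linarith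
    have above: "u 0 y + L\<^sup>2 * \<theta> < F 1 x"
      using contra by (simp add: F_def algebra_simps)
    have initial: "F 0 z \<le> u 0 y + L\<^sup>2 * \<theta>" for z
    proof -
      \<comment> \<open>\<open>L d \<le> d\<^sup>2 / (4 \<theta>) + L\<^sup>2 \<theta>\<close> absorbs the growth of the Lipschitz function \<open>u 0\<close>.\<close>
      have "0 \<le> (dist y z - 2 * L * \<theta>)\<^sup>2 / (4 * \<theta>)" using \<open>0 < \<theta>\<close> by simp
      also have "\<dots> = (dist y z)\<^sup>2 / (4 * \<theta>) + L\<^sup>2 * \<theta> - L * dist y z"
        using \<open>0 < \<theta>\<close> by (simp add: field_simps power2_eq_square)
      finally show ?thesis
        using L[of z y] by (simp add: F_def u_def \<tau>_def)
    qed
    \<comment> \<open>Outside this radius the quadratic penalty exceeds the oscillation of \<open>u\<close>.\<close>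
    define R where "R = sqrt (8 * U * (1 / C + \<theta>))"
    have "0 \<le> R" using \<open>0 \<le> U\<close> \<open>0 < C\<close> \<open>0 < \<theta>\<close> by (simp add: R_def)
    have F_cont: "continuous_on ({0..1} \<times> cball y R) (\<lambda>p. F (fst p) (snd p))"
    proof -
      have "continuous_on ({0..1} \<times> cball y R) (\<lambda>p. \<tau> (fst p))"
        unfolding \<tau>_def using \<open>0 < C\<close> by (intro continuous_intros) auto
      moreover have "4 * \<tau> r + 4 * \<theta> \<noteq> 0" if "0 \<le> r" "r \<le> 1" for r
        using T_pos[of r] that by simp
      moreover have "continuous_on ({0..1} \<times> cball y R) (\<lambda>p. u (fst p) (snd p))"
        by (rule continuous_on_subset[OF u_cont]) auto
      ultimately show ?thesis unfolding F_def by (intro continuous_intros) auto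
    qed
    obtain s z where s: "s \<in> {0..1}"
      and max_ball: "\<And>r w. r \<in> {0..1} \<Longrightarrow> w \<in> cball y R \<Longrightarrow> F r w \<le> F s z"
    proof -
      have "compact ({0..1::real} \<times> cball y R)" by (intro compact_Times) auto
      moreover have "{0..1::real} \<times> cball y R \<noteq> {}" using \<open>0 \<le> R\<close> by auto
      ultimately obtain p where "p \<in> {0..1} \<times> cball y R"
        "\<forall>q\<in>{0..1} \<times> cball y R. F (fst q) (snd q) \<le> F (fst p) (snd p)"
        using continuous_attains_sup[OF _ _ F_cont] by blast
      thus ?thesis by (intro that[of "fst p" "snd p"]) force+
    qed
    have max: "F r w \<le> F s z" if r: "r \<in> {0..1}" for r w
    proof (cases "w \<in> cball y R")
      case False
      hence "R < dist y w" by auto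
      hence "R\<^sup>2 \<le> (dist y w)\<^sup>2" using \<open>0 \<le> R\<close> by (intro power_mono) auto
      moreover have "R\<^sup>2 = 8 * U * (1 / C + \<theta>)"
        using \<open>0 \<le> U\<close> \<open>0 < C\<close> \<open>0 < \<theta>\<close> by (simp add: R_def)
      moreover have "8 * U * (\<tau> r + \<theta>) \<le> 8 * U * (1 / C + \<theta>)"
        using tau[OF r] \<open>0 \<le> U\<close> by (intro mult_left_mono) auto
      ultimately have "8 * U * (\<tau> r + \<theta>) \<le> (dist y w)\<^sup>2" by linarith
      hence "2 * U \<le> (dist y w)\<^sup>2 / (4 * (\<tau> r + \<theta>))"
        using T_pos[OF r] by (simp add: pos_le_divide_eq mult.assoc algebra_simps)
      moreover have "0 \<le> \<theta> * r" using r \<open>0 < \<theta>\<close> by simp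
      ultimately have "F r w \<le> F 0 y"
        using U[OF r, of w] U[of 0 y] by (simp add: F_def)
      also have "\<dots> \<le> F s z" using \<open>0 \<le> R\<close> by (intro max_ball) auto
      finally show ?thesis .
    qed (use r in \<open>rule max_ball\<close>)
    have "s \<noteq> 0" using initial[of z] max[of 1 x] above by auto
    hence "0 < s" using s by simp
    define T where "T = \<tau> s + \<theta>"
    have "0 < T" using T_pos[OF s] by (simp add: T_def)
    \<comment> \<open>\<open>k\<close> is the slope of the quadratic penalty, rescaled from \<open>u\<close> to \<open>v\<close>.\<close>
    define k where "k = exp (- b * s) * (dist y z / (2 * T))"
    have "0 \<le> k" using \<open>0 < T\<close> by (simp add: k_def)
    have slope: "ennreal k \<le> grad_len (v s) z"
    proof (cases "y = z")
      case False
      show ?thesis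
      proof (rule grad_len_ge_descent[OF len False \<open>0 \<le> k\<close>])
        fix e :: real assume "0 < e"
        define \<delta> where "\<delta> = 4 * T * exp (b * s) * e"
        have "(k - e) * (dist y z - dist y w) \<le> v s z - v s w"
          if w: "dist z w < \<delta>" "dist y w \<le> dist y z" for w
        proof -
          let ?D = "dist y z" and ?D' = "dist y w"
          have "F s w \<le> F s z" by (rule max[OF s])
          hence "(?D\<^sup>2 - ?D'\<^sup>2) / (4 * T) \<le> u s z - u s w"
            by (simp add: F_def T_def diff_divide_distrib)
          hence "exp (- b * s) * ((?D\<^sup>2 - ?D'\<^sup>2) / (4 * T)) \<le> exp (- b * s) * (u s z - u s w)"
            by (intro mult_left_mono) auto
          also have "\<dots> = v s z - v s w"
            by (simp add: u_def exp_minus field_simps)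
          also have "(?D\<^sup>2 - ?D'\<^sup>2) / (4 * T) = (?D + ?D') / (4 * T) * (?D - ?D')"
            by (simp add: square_diff_square_factored power2_eq_square)
          finally have 1: "exp (- b * s) * ((?D + ?D') / (4 * T)) * (?D - ?D') \<le> v s z - v s w"
            by (simp only: mult.assoc)
          have "2 * ?D - \<delta> \<le> ?D + ?D'"
            using w dist_triangle[of y z w] by (simp add: dist_commute)
          hence "(2 * ?D - \<delta>) / (4 * T) \<le> (?D + ?D') / (4 * T)"
            using \<open>0 < T\<close> by (intro divide_right_mono) auto
          hence "exp (- b * s) * ((2 * ?D - \<delta>) / (4 * T)) \<le> exp (- b * s) * ((?D + ?D') / (4 * T))"
            by (intro mult_left_mono) auto
          moreover have "exp (- b * s) * ((2 * ?D - \<delta>) / (4 * T)) = k - e"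
            using \<open>0 < T\<close> by (simp add: k_def \<delta>_def field_simps exp_minus)
          ultimately have "(k - e) * (?D - ?D') \<le> exp (- b * s) * ((?D + ?D') / (4 * T)) * (?D - ?D')"
            using w(2) by (intro mult_right_mono) auto
          thus ?thesis using 1 by linarith
        qed
        moreover have "0 < \<delta>" using \<open>0 < T\<close> \<open>0 < e\<close> by (simp add: \<delta>_def)
        ultimately show "\<exists>\<delta>>0. \<forall>w. dist z w < \<delta> \<longrightarrow> dist y w \<le> dist y z \<longrightarrow>
            (k - e) * (dist y z - dist y w) \<le> v s z - v s w"
          by blast
      qed
    qed (simp add: k_def)
    define d where "d = apply_lipb (\<phi>' s) z / apply_lipb (\<phi> s) z"
    have d: "d + b * v s z \<le> - (\<kappa> * k\<^sup>2)"
      unfolding d_def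
      by (rule E_class_slope_ineq[where G = "grad_len (v s) z"])
        (use ineq[OF s, of z] slope \<open>0 \<le> k\<close> \<open>0 < \<kappa>\<close> pos[OF s] in \<open>auto simp: v_def[abs_def]\<close>)
    have "((\<lambda>r. apply_lipb (\<phi> r) z) has_vector_derivative apply_lipb (\<phi>' s) z) (at s within {0..1})"
      by (rule bounded_linear.has_vector_derivative[OF bounded_linear_apply_lipb deriv[OF s]])
    hence D\<phi>: "((\<lambda>r. apply_lipb (\<phi> r) z) has_field_derivative apply_lipb (\<phi>' s) z) (at s within {0..1})"
      by (simp add: has_real_derivative_iff_has_vector_derivative)
    define H where "H = exp (b * s) * (d + b * v s z)
        + (dist y z)\<^sup>2 * (\<kappa> * exp (- b * s)) / (4 * T\<^sup>2) - \<theta>"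
    have D\<tau>: "(\<tau> has_field_derivative \<kappa> * exp (- b * s)) (at s within {0..1})"
      unfolding \<tau>_def using \<open>0 < C\<close>
      by (auto intro!: derivative_eq_intros simp: b_def)
    have D1: "((\<lambda>r. (dist y z)\<^sup>2 / (4 * (\<tau> r + \<theta>))) has_field_derivative
        - ((dist y z)\<^sup>2 * (\<kappa> * exp (- b * s)) / (4 * T\<^sup>2))) (at s within {0..1})"
    proof -
      have "((\<lambda>r. 4 * (\<tau> r + \<theta>)) has_field_derivative 4 * (\<kappa> * exp (- b * s) + 0)) (at s within {0..1})"
        by (intro DERIV_cmult DERIV_add D\<tau> DERIV_const)
      from DERIV_divide[OF DERIV_const[of "(dist y z)\<^sup>2"] this] show ?thesis
        using \<open>0 < T\<close> by (simp add: power2_eq_square mult_ac flip: T_def)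
    qed
    have D2: "((\<lambda>r. u r z) has_field_derivative exp (b * s) * (d + b * v s z)) (at s within {0..1})"
      unfolding u_def v_def d_def
      by (rule derivative_eq_intros D\<phi> refl pos[OF s])+ (simp add: algebra_simps)
    have D3: "((\<lambda>r. \<theta> * r) has_field_derivative \<theta>) (at s within {0..1})"
      by (rule DERIV_cmult_Id)
    have DF: "((\<lambda>r. F r z) has_field_derivative H) (at s within {0..1})"
      using DERIV_diff[OF DERIV_diff[OF D2 D1] D3] by (simp add: F_def H_def)
    have "exp (b * s) * (d + b * v s z) \<le> exp (b * s) * (- (\<kappa> * k\<^sup>2))"
      using d by (intro mult_left_mono) auto
    also have "\<dots> = - ((dist y z)\<^sup>2 * (\<kappa> * exp (- b * s)) / (4 * T\<^sup>2))"
      using \<open>0 < T\<close> by (simp add: k_def power2_eq_square field_simps exp_minus)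
    finally have "H < 0" using \<open>0 < \<theta>\<close> by (simp add: H_def)
    from has_real_derivative_neg_dec_left[OF DF this] obtain e where "0 < e" and
      e: "\<And>h. 0 < h \<Longrightarrow> s - h \<in> {0..1} \<Longrightarrow> h < e \<Longrightarrow> F s z < F (s - h) z"
      by blast
    define h where "h = min s (e / 2)"
    have "F s z < F (s - h) z"
      using \<open>0 < e\<close> \<open>0 < s\<close> s by (intro e) (auto simp: h_def min_def)
    moreover have "F (s - h) z \<le> F s z"
      using \<open>0 < e\<close> \<open>0 < s\<close> s by (intro max) (auto simp: h_def min_def)
    ultimately show False by simp
  qed
  have "u 1 x \<le> u 0 y + (dist y x)\<^sup>2 / (4 * \<tau> 1)"
  proof (rule field_le_epsilon)
    fix e :: real assume "0 < e"
    define \<theta> where "\<theta> = e / (L\<^sup>2 + 1)"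
    have L1: "0 < L\<^sup>2 + 1" by (simp add: add_nonneg_pos)
    hence "0 < \<theta>" using \<open>0 < e\<close> by (simp add: \<theta>_def)
    have "(dist y x)\<^sup>2 / (4 * (\<tau> 1 + \<theta>)) \<le> (dist y x)\<^sup>2 / (4 * \<tau> 1)"
      using \<open>0 < \<tau> 1\<close> \<open>0 < \<theta>\<close> by (intro divide_left_mono) auto
    moreover have "(L\<^sup>2 + 1) * \<theta> = e" using L1 by (simp add: \<theta>_def)
    ultimately show "u 1 x \<le> u 0 y + (dist y x)\<^sup>2 / (4 * \<tau> 1) + e"
      using key[OF \<open>0 < \<theta>\<close>] by linarith
  qed
  thus ?thesis by (simp add: u_def v_def \<tau>_def dist_commute field_simps)
qed

section \<open>From entropic transport to the Harnack inequality\<close>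

lemma powr_above_tangent:
  fixes t t0 p :: real
  assumes "1 < p" "0 < t" "0 < t0"
  shows "t0 powr p + p * t0 powr (p - 1) * (t - t0) \<le> t powr p"
proof -
  define q where "q = p / (p - 1)"
  have q: "1 < q" "1 / p + 1 / q = 1" "(p - 1) * q = p"
    using assms(1) by (auto simp: q_def field_simps)
  have "t * t0 powr (p - 1) \<le> t powr p / p + (t0 powr (p - 1)) powr q / q"
    using assms q by (intro Youngs_inequality) auto
  also have "(t0 powr (p - 1)) powr q = t0 powr p" by (simp add: powr_powr q)
  finally have "p * (t * t0 powr (p - 1)) \<le> p * (t powr p / p + t0 powr p / q)"
    using assms(1) by (intro mult_left_mono) auto
  also have "\<dots> = t powr p + (p - 1) * t0 powr p"
    using assms(1) by (simp add: q_def field_simps)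
  finally have "p * (t * t0 powr (p - 1)) \<le> t powr p + (p - 1) * t0 powr p" .
  moreover have "t0 powr p = t0 * t0 powr (p - 1)"
    using assms by (simp add: powr_mult_base)
  ultimately show ?thesis by (simp add: algebra_simps)
qed

text \<open>The graph of \<open>t powr p\<close> lies above its tangent at the critical point \<open>t0\<close>, where that tangent has
  slope \<open>1 / B\<close>.\<close>

lemma linear_minus_powr_le_max:
  fixes B p t :: real
  assumes "1 < p" "0 < B" "0 < t"
  defines "t0 \<equiv> (1 / (p * B)) powr (1 / (p - 1))"
  shows "t - B * t powr p \<le> t0 - B * t0 powr p"
proof -
  have "0 < t0" using assms by (simp add: t0_def)
  have "t0 powr (p - 1) = 1 / (p * B)"
    using assms by (simp add: t0_def powr_powr)
  hence "t0 powr p + (t - t0) / B \<le> t powr p"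
    using powr_above_tangent[OF assms(1,3) \<open>0 < t0\<close>] assms by simp
  hence "B * (t0 powr p + (t - t0) / B) \<le> B * t powr p"
    using assms by (intro mult_left_mono) auto
  moreover have "B * (t0 powr p + (t - t0) / B) = B * t0 powr p + (t - t0)"
    using \<open>0 < B\<close> by (simp add: field_simps)
  ultimately show ?thesis by linarith
qed

text \<open>The curve \<open>s \<mapsto> f powr exp (- b s)\<close> with \<open>f = exp g\<close> satisfies the differential inequality of
  \<open>E_class 0 b\<close> with equality. Its end points differ by the power \<open>exp b\<close>, which is how the exponent of
  the Harnack inequality enters.\<close>

lemma entropy_flow_E_class:
  fixes g :: "'a::metric_space lipb"
  assumes "0 \<le> b"
  shows "(\<lambda>s. exp (exp (- b * s) *\<^sub>R g)) \<in> E_class 0 b"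
proof -
  define c where "c s = exp (- b * s)" for s
  define \<phi>' where "\<phi>' s = (- b * c s) *\<^sub>R (exp (c s *\<^sub>R g) * g)" for s
  have c_deriv: "(c has_vector_derivative - b * c s) (at s within S)" for s S
    unfolding c_def has_real_derivative_iff_has_vector_derivative[symmetric]
    by (auto intro!: derivative_eq_intros)
  have bounds: "exp (- norm g) \<le> apply_lipb (exp (c s *\<^sub>R g)) x \<and> apply_lipb (exp (c s *\<^sub>R g)) x \<le> exp (norm g)"
    if "s \<in> {0..1}" for s x
  proof -
    have "\<bar>c s * apply_lipb g x\<bar> \<le> 1 * norm g"
      unfolding abs_mult using that assms
      by (intro mult_mono abs_apply_lipb_le) (auto simp: c_def)
    thus ?thesis by (simp add: apply_lipb_exp scaleR_lipb.rep_eq abs_le_iff)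
  qed
  have deriv: "((\<lambda>s. exp (c s *\<^sub>R g)) has_vector_derivative \<phi>' s) (at s within {0..1})" for s
    using vector_diff_chain_within[OF c_deriv exp_scaleR_has_vector_derivative_right]
    by (simp add: o_def \<phi>'_def)
  have "continuous_on {0..1} (\<lambda>s. exp (c s *\<^sub>R g))"
    unfolding continuous_on_eq_continuous_within
    using deriv has_vector_derivative_continuous by blast
  moreover have "continuous_on {0..1} c"
    unfolding c_def by (intro continuous_intros)
  ultimately have "continuous_on {0..1} \<phi>'"
    unfolding \<phi>'_def by (intro continuous_intros)
  moreover have "ereal (apply_lipb (\<phi>' s) x)
      + ereal (0 * apply_lipb (exp (c s *\<^sub>R g)) x) * (enn2ereal (grad_len (\<lambda>z. ln (apply_lipb (exp (c s *\<^sub>R g)) z)) x))\<^sup>2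
      + ereal (b * (apply_lipb (exp (c s *\<^sub>R g)) x * ln (apply_lipb (exp (c s *\<^sub>R g)) x))) \<le> 0" for s x
    by (simp add: \<phi>'_def apply_lipb_exp scaleR_lipb.rep_eq times_lipb.rep_eq uminus_lipb.rep_eq algebra_simps
        flip: zero_ereal_def)
  ultimately show ?thesis
    unfolding E_class_def mem_Collect_eq c_def[symmetric]
    by (intro conjI exI[of _ "exp (- norm g)"] exI[of _ "exp (norm g)"] exI[of _ \<phi>'] ballI allI)
      (use bounds deriv in auto)
qed

locale entropic_transport_kernel = probability_kernel P
  for P :: "'a::heine_borel \<Rightarrow> 'a measure" +
  fixes C :: real
  assumes length_space: "length_space TYPE('a)" and C_pos: "0 < C"
    and eti: "entropic_transport_ineq P C"
begin

text \<open>Apply the transport inequality with \<open>\<kappa> = ln p / C\<close> to the Dirac measures at \<open>y\<close> and \<open>x\<close>. On the left,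
  test with a curve from \<open>(lam * f) powr p\<close> to \<open>lam * f\<close>, for a free scaling \<open>lam > 0\<close>. On the right, the
  comparison with the Hopf-Lax solution reduces everything to maximising \<open>t - B t powr p\<close>, where \<open>B\<close> is the
  reciprocal of the Harnack constant. Scaling such that \<open>lam * P f x\<close> is the maximiser gives the claim.\<close>

lemma wang_harnack_bounded_below:
  assumes "1 < p" and f: "f \<in> Lip_b" and "0 < m" and m: "\<And>x. m \<le> f x"
  shows "kernel_app P f x powr p
    \<le> exp (p / (p - 1) * (C * (dist x y)\<^sup>2 / 4)) * kernel_app P (\<lambda>z. f z powr p) y"
proof -
  define \<kappa> where "\<kappa> = ln p / C"
  have \<kappa>: "0 < \<kappa>" "\<kappa> * C = ln p" using \<open>1 < p\<close> C_pos by (simp_all add: \<kappa>_def)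
  define A where "A = p / (p - 1) * (C * (dist x y)\<^sup>2 / 4)"
  define B where "B = exp (- A)"
  define a where "a = kernel_app P f x"
  define N where "N = kernel_app P (\<lambda>z. f z powr p) y"
  define t0 where "t0 = (1 / (p * B)) powr (1 / (p - 1))"
  have "0 < B" "0 < t0" using \<open>1 < p\<close> by (simp_all add: B_def t0_def)
  have fpos: "0 < f z" for z using m[of z] \<open>0 < m\<close> by linarith
  have "m \<le> a" unfolding a_def by (intro kernel_app_ge integrable_Lip_b f m)
  hence "0 < a" using \<open>0 < m\<close> by simp
  define lam where "lam = t0 / a"
  have "0 < lam" using \<open>0 < t0\<close> \<open>0 < a\<close> by (simp add: lam_def)
  have "(\<lambda>z. p * ln (lam * f z)) \<in> Lip_b"
    using m \<open>0 < lam\<close> \<open>0 < m\<close> by (intro Lip_b_scale Lip_b_ln[of _ "lam * m"] f) auto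
  then obtain g where g: "apply_lipb g = (\<lambda>z. p * ln (lam * f z))"
    by (metis Abs_lipb_inverse)
  define \<phi> where "\<phi> s = exp (exp (- ln p * s) *\<^sub>R g)" for s
  have \<phi>: "\<phi> \<in> E_class 0 (\<kappa> * C)"
    using entropy_flow_E_class[of "ln p" g] \<open>1 < p\<close> unfolding \<phi>_def \<kappa> by simp
  have \<phi>1: "apply_lipb (\<phi> 1) z = lam * f z" for z
    using \<open>1 < p\<close> fpos[of z] \<open>0 < lam\<close>
    by (simp add: \<phi>_def apply_lipb_exp scaleR_lipb.rep_eq g exp_minus flip: mult.assoc)
  have \<phi>0: "apply_lipb (\<phi> 0) z = lam powr p * f z powr p" for z
    using fpos[of z] \<open>0 < lam\<close>
    by (simp add: \<phi>_def apply_lipb_exp scaleR_lipb.rep_eq g powr_def ln_mult_pos distrib_left exp_add)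
  have dirac: "return borel z \<in> prob_measures" for z :: 'a
    by (simp add: space_prob_algebra prob_space_return)
  have "ereal (lam * a - lam powr p * N)
      = ereal ((\<integral>z. apply_lipb (\<phi> 1) z \<partial>(return borel x \<bind> P)) - (\<integral>z. apply_lipb (\<phi> 0) z \<partial>(return borel y \<bind> P)))"
    by (simp add: return_bind_kernel \<phi>1 \<phi>0 a_def N_def kernel_app_def)
  also have "\<dots> \<le> T_cost 0 (\<kappa> * C) (return borel y \<bind> P) (return borel x \<bind> P)"
    unfolding T_cost_def by (rule SUP_upper[OF \<phi>])
  also have "\<dots> \<le> T_cost \<kappa> (\<kappa> * C) (return borel y) (return borel x)"
    using eti dirac \<kappa>(1) by (auto simp: entropic_transport_ineq_def)
  also have "\<dots> \<le> ereal (t0 - B * t0 powr p)"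
    unfolding T_cost_def
  proof (rule SUP_least)
    fix \<psi> :: "real \<Rightarrow> 'a lipb" assume \<psi>: "\<psi> \<in> E_class \<kappa> (\<kappa> * C)"
    let ?s = "apply_lipb (\<psi> 0) y" and ?t = "apply_lipb (\<psi> 1) x"
    from E_classD[OF \<psi>] obtain m' where "0 < m'"
      "\<And>s z. s \<in> {0..1} \<Longrightarrow> m' \<le> apply_lipb (\<psi> s) z"
      by metis
    from this(1) this(2)[of 0 y] this(2)[of 1 x] have pos: "0 < ?s" "0 < ?t" by auto
    have "p * ln ?t \<le> ln ?s + C * (dist x y)\<^sup>2 / (4 * (1 - 1 / p))"
      using hamilton_jacobi_bound[OF length_space C_pos \<kappa>(1) \<psi>, of x y] \<open>1 < p\<close>
      by (simp add: \<kappa> exp_minus inverse_eq_divide)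
    also have "C * (dist x y)\<^sup>2 / (4 * (1 - 1 / p)) = A"
      using \<open>1 < p\<close> by (simp add: A_def field_simps)
    finally have "exp (p * ln ?t - A) \<le> exp (ln ?s)" by simp
    hence "B * ?t powr p \<le> ?s"
      using pos by (simp add: B_def powr_def exp_diff exp_minus field_simps)
    hence "?t - ?s \<le> ?t - B * ?t powr p" by simp
    also have "\<dots> \<le> t0 - B * t0 powr p"
      unfolding t0_def by (rule linear_minus_powr_le_max[OF \<open>1 < p\<close> \<open>0 < B\<close> pos(2)])
    finally show "ereal ((\<integral>z. apply_lipb (\<psi> 1) z \<partial>return borel x) - (\<integral>z. apply_lipb (\<psi> 0) z \<partial>return borel y))
        \<le> ereal (t0 - B * t0 powr p)"
      by (simp add: integral_return Lip_b_measurable)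
  qed
  finally have "lam * a - lam powr p * N \<le> t0 - B * t0 powr p" by simp
  hence "B * t0 powr p \<le> t0 powr p * (N / a powr p)"
    using \<open>0 < a\<close> \<open>0 < t0\<close> by (simp add: lam_def powr_divide)
  hence "t0 powr p * B \<le> t0 powr p * (N / a powr p)" by (simp only: mult.commute)
  hence "B \<le> N / a powr p"
    using \<open>0 < t0\<close> by (subst (asm) mult_le_cancel_left_pos) auto
  hence "B * a powr p \<le> N" using \<open>0 < a\<close> by (simp add: field_simps)
  hence "exp A * (B * a powr p) \<le> exp A * N" by (intro mult_left_mono) auto
  moreover have "exp A * (B * a powr p) = a powr p" by (simp add: B_def exp_minus)
  ultimately show ?thesis unfolding A_def a_def N_def by linarith
qed

lemma wang_harnack: "wang_harnack P C"
  unfolding wang_harnack_def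
proof (intro allI impI ballI)
  fix p :: real and f :: "'a \<Rightarrow> real" and x y :: 'a
  assume "1 < p" and f: "f \<in> Lip_b" and "\<forall>x. 0 < f x"
  hence fpos: "0 < f z" for z by blast
  define A where "A = exp (p / (p - 1) * (C * (dist x y)\<^sup>2 / 4))"
  define K where "K = p * (sup_abs f + 1) powr (p - 1)"
  have fle: "f z \<le> sup_abs f" for z using abs_le_sup_abs[OF f, of z] by simp
  have "0 < sup_abs f" using fpos fle less_le_trans by blast
  have "0 < A" "0 < K" using \<open>1 < p\<close> \<open>0 < sup_abs f\<close> by (simp_all add: A_def K_def)
  have int: "integrable (P y) (\<lambda>z. f z powr p)"
  proof (rule integrable_kernel)
    show "\<bar>f z powr p\<bar> \<le> sup_abs f powr p" for z
      using fle[of z] fpos[of z] \<open>1 < p\<close> by (simp add: powr_mono2)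
  qed (use Lip_b_measurable[OF f] in measurable)
  have approx: "kernel_app P f x powr p \<le> A * kernel_app P (\<lambda>z. f z powr p) y + A * K * e"
    if e: "0 < e" "e \<le> 1" for e
  proof -
    have fe: "(\<lambda>z. f z + e) \<in> Lip_b" by (intro Lip_b_add f Lip_b_const)
    have le: "(f z + e) powr p \<le> f z powr p + K * e" for z
    proof -
      have "(f z + e) powr p + p * (f z + e) powr (p - 1) * (f z - (f z + e)) \<le> f z powr p"
        using \<open>1 < p\<close> fpos[of z] e by (intro powr_above_tangent) auto
      moreover have "p * (f z + e) powr (p - 1) \<le> K"
        unfolding K_def using \<open>1 < p\<close> fpos[of z] fle[of z] e
        by (intro mult_left_mono powr_mono2) auto
      hence "p * (f z + e) powr (p - 1) * e \<le> K * e" using e by (intro mult_right_mono) auto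
      ultimately show ?thesis by simp
    qed
    have "kernel_app P f x powr p \<le> kernel_app P (\<lambda>z. f z + e) x powr p"
      using \<open>1 < p\<close> e fpos
      by (intro powr_mono2 kernel_app_mono kernel_app_ge integrable_Lip_b f fe) (auto intro: less_imp_le)
    also have "\<dots> \<le> A * kernel_app P (\<lambda>z. (f z + e) powr p) y"
      unfolding A_def
      using \<open>1 < p\<close> e fpos by (intro wang_harnack_bounded_below[of _ _ e] fe) (auto intro: less_imp_le)
    also have "\<dots> \<le> A * kernel_app P (\<lambda>z. f z powr p + K * e) y"
    proof (intro mult_left_mono kernel_app_mono le)
      show "integrable (P y) (\<lambda>z. (f z + e) powr p)"
        using e fpos by (intro integrable_Lip_b Lip_b_powr[OF fe, of e]) (auto intro: less_imp_le)
      show "integrable (P y) (\<lambda>z. f z powr p + K * e)"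
        by (intro Bochner_Integration.integrable_add int integrable_Lip_b Lip_b_const)
    qed (use \<open>0 < A\<close> in simp)
    also have "kernel_app P (\<lambda>z. f z powr p + K * e) y = kernel_app P (\<lambda>z. f z powr p) y + K * e"
      by (subst kernel_app_add[OF int]) (auto intro: integrable_Lip_b Lip_b_const)
    finally show ?thesis by (simp add: algebra_simps)
  qed
  show "kernel_app P f x powr p \<le> A * kernel_app P (\<lambda>z. f z powr p) y"
  proof (rule field_le_epsilon)
    fix e :: real assume "0 < e"
    define e' where "e' = min 1 (e / (A * K))"
    have "0 < e'" "e' \<le> 1" "A * K * e' \<le> e"
      using \<open>0 < e\<close> \<open>0 < A\<close> \<open>0 < K\<close> by (auto simp: e'_def min_def field_simps)
    thus "kernel_app P f x powr p \<le> A * kernel_app P (\<lambda>z. f z powr p) y + e"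
      using approx[of e'] by linarith
  qed
qed

end

section \<open>From the Harnack inequality to the reverse logarithmic Sobolev inequality\<close>

lemma exp_quadratic_remainder: "\<bar>exp x - 1 - x\<bar> \<le> exp \<bar>x\<bar> / 2 * x\<^sup>2" for x :: real
proof -
  obtain t where t: "\<bar>t\<bar> \<le> \<bar>x\<bar>" "exp x = (\<Sum>m<2. x ^ m / fact m) + exp t / fact 2 * x\<^sup>2"
    using Maclaurin_exp_le[of x 2] by blast
  hence "exp x - 1 - x = exp t / 2 * x\<^sup>2" by (simp add: numeral_2_eq_2)
  hence "\<bar>exp x - 1 - x\<bar> = exp t / 2 * x\<^sup>2" by (simp only: abs_mult) simp
  moreover have "exp t / 2 * x\<^sup>2 \<le> exp \<bar>x\<bar> / 2 * x\<^sup>2"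
    using t(1) by (intro mult_right_mono) auto
  ultimately show ?thesis by simp
qed

lemma mult_exp_abs_ln_le:
  fixes c M :: real
  assumes "0 < c" "c \<le> M" "1 \<le> M"
  shows "c * exp \<bar>ln c\<bar> \<le> M\<^sup>2"
proof (cases "1 \<le> c")
  case True
  hence "c * exp \<bar>ln c\<bar> = c\<^sup>2" by (simp add: power2_eq_square)
  thus ?thesis using assms by (simp add: power_mono)
next
  case False
  hence "c * exp \<bar>ln c\<bar> = 1" using assms by (simp add: exp_minus abs_of_neg)
  thus ?thesis using assms by (simp add: one_le_power)
qed

text \<open>The constant is uniform in \<open>c \<in> (0, M]\<close>: the logarithms that appear when \<open>c\<close> is small are absorbed
  by the factor \<open>c\<close>. Hence the expansion in \<open>h\<close> may be integrated for functions that are positive but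
  not bounded away from \<open>0\<close>.\<close>

lemma powr_quadratic_remainder:
  fixes c h M :: real
  assumes c: "0 < c" "c \<le> M" "1 \<le> M" and h: "\<bar>h\<bar> \<le> 1/2"
  shows "\<bar>c powr (1 + h) - c - h * (c * ln c)\<bar> \<le> 4 * M\<^sup>2 * h\<^sup>2"
proof -
  let ?L = "ln c"
  have "?L\<^sup>2 \<le> 8 * exp (\<bar>?L\<bar> / 2)"
    using exp_lower_Taylor_quadratic[of "\<bar>?L\<bar> / 2"] by (simp add: power_divide)
  hence "exp (\<bar>?L\<bar> / 2) * ?L\<^sup>2 \<le> exp (\<bar>?L\<bar> / 2) * (8 * exp (\<bar>?L\<bar> / 2))"
    by (intro mult_left_mono) auto
  also have "\<dots> = 8 * exp \<bar>?L\<bar>" by (simp flip: exp_add)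
  finally have L: "exp (\<bar>?L\<bar> / 2) * ?L\<^sup>2 \<le> 8 * exp \<bar>?L\<bar>" .
  have "c powr (1 + h) = c * exp (h * ?L)"
    using c by (simp add: powr_def exp_add distrib_right)
  hence "c powr (1 + h) - c - h * (c * ?L) = c * (exp (h * ?L) - 1 - h * ?L)"
    by (simp add: algebra_simps)
  hence "\<bar>c powr (1 + h) - c - h * (c * ?L)\<bar> = c * \<bar>exp (h * ?L) - 1 - h * ?L\<bar>"
    using c(1) by (simp only: abs_mult abs_of_pos)
  also have "\<dots> \<le> c * (exp \<bar>h * ?L\<bar> / 2 * (h * ?L)\<^sup>2)"
    using c(1) by (intro mult_left_mono exp_quadratic_remainder) auto
  also have "\<dots> \<le> c * (exp (\<bar>?L\<bar> / 2) / 2 * (h * ?L)\<^sup>2)"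
  proof -
    have "\<bar>h * ?L\<bar> \<le> \<bar>?L\<bar> / 2"
      using mult_right_mono[OF h, of "\<bar>?L\<bar>"] by (simp add: abs_mult)
    thus ?thesis using c(1) by (intro mult_left_mono mult_right_mono divide_right_mono) auto
  qed
  also have "\<dots> = c / 2 * h\<^sup>2 * (exp (\<bar>?L\<bar> / 2) * ?L\<^sup>2)"
    by (simp add: power_mult_distrib)
  also have "\<dots> \<le> c / 2 * h\<^sup>2 * (8 * exp \<bar>?L\<bar>)"
    using c(1) L by (intro mult_left_mono) auto
  also have "\<dots> = 4 * h\<^sup>2 * (c * exp \<bar>?L\<bar>)" by simp
  also have "\<dots> \<le> 4 * h\<^sup>2 * M\<^sup>2"
    using mult_exp_abs_ln_le[OF c] by (intro mult_left_mono) auto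
  finally show ?thesis by (simp add: mult_ac)
qed

lemma DERIV_if_quadratic_remainder:
  fixes N :: "real \<Rightarrow> real"
  assumes "0 < d" and rem: "\<And>h. \<bar>h\<bar> \<le> d \<Longrightarrow> \<bar>N (x + h) - N x - h * D\<bar> \<le> K * h\<^sup>2"
  shows "(N has_real_derivative D) (at x)"
  unfolding DERIV_def
proof (rule LIM_zero_cancel, rule Lim_null_comparison)
  show "\<forall>\<^sub>F h in at 0. norm ((N (x + h) - N x) / h - D) \<le> K * \<bar>h\<bar>"
    unfolding eventually_at
  proof (intro exI[of _ d] conjI ballI impI \<open>0 < d\<close>)
    fix h :: real assume h: "h \<noteq> 0 \<and> dist h 0 < d"
    have "(N (x + h) - N x) / h - D = (N (x + h) - N x - h * D) / h"
      using h by (simp add: field_simps)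
    hence "norm ((N (x + h) - N x) / h - D) = \<bar>N (x + h) - N x - h * D\<bar> / \<bar>h\<bar>" by simp
    also have "\<dots> \<le> K * h\<^sup>2 / \<bar>h\<bar>" using rem[of h] h by (intro divide_right_mono) auto
    also have "\<dots> = K * \<bar>h\<bar>" using h by (simp add: power2_eq_square abs_if)
    finally show "norm ((N (x + h) - N x) / h - D) \<le> K * \<bar>h\<bar>" .
  qed
  have "((\<lambda>h::real. K * \<bar>h\<bar>) \<longlongrightarrow> K * \<bar>0\<bar>) (at 0)" by (intro tendsto_intros)
  thus "((\<lambda>h::real. K * \<bar>h\<bar>) \<longlongrightarrow> 0) (at 0)" by simp
qed

locale wang_harnack_kernel = probability_kernel P
  for P :: "'a::metric_space \<Rightarrow> 'a measure" +
  fixes C :: real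
  assumes C_pos: "0 < C" and wh: "wang_harnack P C"
begin

text \<open>The Harnack inequality for \<open>f powr (1 / p)\<close>, which need not be Lipschitz. It bounds \<open>P f\<close> at \<open>y\<close> from below
  by quantities at \<open>x\<close>, just as the original form bounds it from above, so both bounds can be
  expanded at the same fixed point.\<close>

lemma wang_harnack_root:
  assumes "1 < p" and f: "f \<in> Lip_b" "\<And>x. 0 < f x"
  shows "kernel_app P (\<lambda>z. f z powr (1 / p)) x powr p
    \<le> exp (p / (p - 1) * (C * (dist x y)\<^sup>2 / 4)) * kernel_app P f y"
proof -
  define A where "A = exp (p / (p - 1) * (C * (dist x y)\<^sup>2 / 4))"
  have "0 < A" by (simp add: A_def)
  have fle: "f z \<le> sup_abs f" for z using abs_le_sup_abs[OF f(1), of z] by simp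
  have int: "integrable (P x) (\<lambda>z. f z powr (1 / p))"
  proof (rule integrable_kernel)
    show "\<bar>f z powr (1 / p)\<bar> \<le> sup_abs f powr (1 / p)" for z
      using fle[of z] f(2)[of z] \<open>1 < p\<close> by (simp add: powr_mono2)
  qed (use Lip_b_measurable[OF f(1)] in measurable)
  have "kernel_app P (\<lambda>z. f z powr (1 / p)) x powr p \<le> A * kernel_app P f y"
  proof (rule field_le_epsilon)
    fix e :: real assume "0 < e"
    define e' where "e' = e / A"
    have e': "0 < e'" "A * e' = e" using \<open>0 < e\<close> \<open>0 < A\<close> by (auto simp: e'_def)
    define g where "g z = (f z + e') powr (1 / p)" for z
    have gpos: "0 < g z" for z using f(2)[of z] e' by (simp add: g_def add_pos_pos)
    have g: "g \<in> Lip_b"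
      unfolding g_def using e' f(2)
      by (intro Lip_b_powr[of _ e'] Lip_b_add f(1) Lip_b_const) (auto intro: less_imp_le)
    have "kernel_app P (\<lambda>z. f z powr (1 / p)) x powr p \<le> kernel_app P g x powr p"
    proof (intro powr_mono2 kernel_app_mono kernel_app_ge int)
      show "f z powr (1 / p) \<le> g z" for z
        unfolding g_def using f(2)[of z] e' \<open>1 < p\<close> by (intro powr_mono2) auto
    qed (use \<open>1 < p\<close> integrable_Lip_b[OF g] in auto)
    also have "\<dots> \<le> A * kernel_app P (\<lambda>z. g z powr p) y"
      using wh \<open>1 < p\<close> g gpos by (auto simp: wang_harnack_def A_def)
    also have "(\<lambda>z. g z powr p) = (\<lambda>z. f z + e')"
      using f(2) e' \<open>1 < p\<close> by (auto simp: g_def powr_powr add_pos_pos less_imp_le intro!: powr_one)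
    also have "kernel_app P (\<lambda>z. f z + e') y = kernel_app P f y + e'"
      by (subst kernel_app_add) (auto intro: integrable_Lip_b f Lip_b_const)
    finally show "kernel_app P (\<lambda>z. f z powr (1 / p)) x powr p \<le> A * kernel_app P f y + e"
      using e' by (simp add: distrib_left)
  qed
  thus ?thesis by (simp add: A_def)
qed

text \<open>The derivative at \<open>q = 1\<close> of \<open>ln (P (f powr q)) / q\<close>, the logarithm of the \<open>q\<close>-th power mean, is
  the entropy of \<open>f\<close> divided by \<open>P f\<close>.\<close>

lemma power_mean_deriv:
  fixes z :: 'a
  assumes f: "f \<in> Lip_b" "\<And>x. 0 < f x"
  defines "N \<equiv> \<lambda>q. kernel_app P (\<lambda>y. f y powr q) z"
  shows "0 \<le> q \<Longrightarrow> 0 < N q"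
    and "((\<lambda>q. ln (N q) / q) has_real_derivative
      kernel_app P (\<lambda>y. f y * ln (f y)) z / N 1 - ln (N 1)) (at 1)"
proof -
  define M where "M = max 1 (sup_abs f)"
  have M: "f y \<le> M" "1 \<le> M" for y using abs_le_sup_abs[OF f(1), of y] by (auto simp: M_def)
  note [measurable] = Lip_b_measurable[OF f(1)]
  have int_powr: "integrable (P z) (\<lambda>y. f y powr q)" if "0 \<le> q" for q
  proof (rule integrable_kernel)
    show "\<bar>f y powr q\<bar> \<le> M powr q" for y
      using M(1)[of y] f(2)[of y] that by (simp add: powr_mono2)
  qed measurable
  have int_ln: "integrable (P z) (\<lambda>y. f y * ln (f y))"
  proof (rule integrable_kernel)
    show "\<bar>f y * ln (f y)\<bar> \<le> M\<^sup>2" for y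
    proof -
      have "\<bar>f y * ln (f y)\<bar> \<le> f y * exp \<bar>ln (f y)\<bar>"
      proof -
        have "\<bar>ln (f y)\<bar> \<le> exp \<bar>ln (f y)\<bar>"
          using exp_ge_add_one_self[of "\<bar>ln (f y)\<bar>"] by linarith
        thus ?thesis using f(2)[of y] by (simp add: abs_mult)
      qed
      also have "\<dots> \<le> M\<^sup>2" using f(2) M by (intro mult_exp_abs_ln_le)
      finally show ?thesis .
    qed
  qed measurable
  show pos: "0 < N q" if "0 \<le> q" for q
    unfolding N_def using f(2) by (intro kernel_app_pos int_powr that) (simp add: less_imp_neq[symmetric])
  let ?D = "kernel_app P (\<lambda>y. f y * ln (f y)) z"
  have "\<bar>N (1 + h) - N 1 - h * ?D\<bar> \<le> 4 * M\<^sup>2 * h\<^sup>2" if h: "\<bar>h\<bar> \<le> 1/2" for h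
  proof -
    let ?r = "\<lambda>y. f y powr (1 + h) - f y - h * (f y * ln (f y))"
    have ip: "integrable (P z) (\<lambda>y. f y powr (1 + h))" using h by (intro int_powr) (simp add: abs_le_iff)
    have i1: "integrable (P z) f" by (rule integrable_Lip_b[OF f(1)])
    have "kernel_app P ?r z = N (1 + h) - N 1 - h * ?D"
      unfolding kernel_app_def N_def using ip i1 int_ln f(2) by (simp add: less_imp_le)
    moreover have int_r: "integrable (P z) ?r" using ip i1 int_ln by simp
    moreover have rem: "\<bar>?r y\<bar> \<le> 4 * M\<^sup>2 * h\<^sup>2" for y
      using f(2) M h by (intro powr_quadratic_remainder)
    have "- (4 * M\<^sup>2 * h\<^sup>2) \<le> ?r y" for y using rem[of y] by linarith
    hence "- (4 * M\<^sup>2 * h\<^sup>2) \<le> kernel_app P ?r z" by (rule kernel_app_ge[OF int_r])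
    moreover have "kernel_app P ?r z \<le> 4 * M\<^sup>2 * h\<^sup>2"
      by (rule kernel_app_le[OF int_r abs_le_D1[OF rem]])
    ultimately show ?thesis by linarith
  qed
  hence N': "(N has_real_derivative ?D) (at 1)"
    by (intro DERIV_if_quadratic_remainder[of "1/2"]) auto
  have "((\<lambda>q. ln (N q) / q) has_real_derivative (1 / N 1 * ?D * 1 - ln (N 1) * 1) / (1 * 1)) (at 1)"
    using pos[of 1] by (intro DERIV_divide DERIV_ident DERIV_chain2[OF DERIV_ln_divide N']) auto
  thus "((\<lambda>q. ln (N q) / q) has_real_derivative ?D / N 1 - ln (N 1)) (at 1)" by simp
qed

text \<open>At distance \<open>r\<close> take the exponent \<open>p = 1 + lam * r\<close>. Then the Harnack constant contributes
  \<open>C r / (4 lam)\<close> to the difference of \<open>ln (P f)\<close>, and the change of the power mean contributes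
  \<open>lam * E * r\<close>, both up to \<open>o(r)\<close>.\<close>

lemma grad_len_ln_kernel_le:
  fixes z :: 'a
  assumes f: "f \<in> Lip_b" "\<And>x. 0 < f x" and "0 < lam" "0 < e"
  defines "E \<equiv> kernel_app P (\<lambda>y. f y * ln (f y)) z / kernel_app P f z - ln (kernel_app P f z)"
  shows "grad_len (\<lambda>w. ln (kernel_app P f w)) z \<le> ennreal (C / (4 * lam) + lam * E + e)"
proof -
  define N where "N q = kernel_app P (\<lambda>y. f y powr q) z" for q
  define \<Phi> where "\<Phi> q = ln (N q) / q" for q
  have N1: "N 1 = kernel_app P f z" using f(2) by (simp add: N_def less_imp_le)
  have Npos: "0 < N q" if "0 \<le> q" for q
    unfolding N_def by (rule power_mean_deriv(1)[OF f that])
  have D\<Phi>: "(\<Phi> has_real_derivative E) (at 1)"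
    using power_mean_deriv(2)[OF f, of z] unfolding \<Phi>_def E_def N_def[symmetric] N1 .
  have Fpos: "0 < kernel_app P f w" for w
    by (intro kernel_app_pos integrable_Lip_b f)
  define A1 where "A1 r = C / (4 * lam) + (\<Phi> (1 + lam * r) - \<Phi> 1) / r" for r
  define A2 where "A2 r = (1 + lam * r) * (C / (4 * lam)) + (\<Phi> 1 - \<Phi> (1 / (1 + lam * r))) / r" for r
  have "((\<lambda>r. \<Phi> (1 + lam * r)) has_real_derivative E * lam) (at 0)"
    by (rule DERIV_chain2[where g = "\<lambda>r. 1 + lam * r"])
      (auto intro!: derivative_eq_intros D\<Phi>)
  hence "((\<lambda>r. (\<Phi> (1 + lam * r) - \<Phi> 1) / r) \<longlongrightarrow> E * lam) (at_right 0)"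
    by (auto simp: DERIV_def filterlim_at_split)
  hence lim1: "(A1 \<longlongrightarrow> C / (4 * lam) + E * lam) (at_right 0)"
    unfolding A1_def by (intro tendsto_intros)
  have "((\<lambda>r. \<Phi> (1 / (1 + lam * r))) has_real_derivative E * (- lam)) (at 0)"
    by (rule DERIV_chain2[where g = "\<lambda>r. 1 / (1 + lam * r)"])
      (auto intro!: derivative_eq_intros D\<Phi>)
  hence "((\<lambda>r. (\<Phi> (1 / (1 + lam * r)) - \<Phi> 1) / r) \<longlongrightarrow> E * (- lam)) (at_right 0)"
    by (auto simp: DERIV_def filterlim_at_split)
  from tendsto_minus[OF this]
  have "((\<lambda>r. (\<Phi> 1 - \<Phi> (1 / (1 + lam * r))) / r) \<longlongrightarrow> E * lam) (at_right 0)"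
    by (simp add: diff_divide_distrib)
  moreover have "((\<lambda>r. (1 + lam * r) * (C / (4 * lam))) \<longlongrightarrow> (1 + lam * 0) * (C / (4 * lam))) (at_right 0)"
    by (intro tendsto_intros)
  ultimately have lim2: "(A2 \<longlongrightarrow> C / (4 * lam) + E * lam) (at_right 0)"
    unfolding A2_def by (intro tendsto_add) simp_all
  let ?c = "C / (4 * lam) + lam * E + e"
  have "C / (4 * lam) + E * lam < ?c" using \<open>0 < e\<close> by (simp add: mult.commute)
  from eventually_conj[OF order_tendstoD(2)[OF lim1 this] order_tendstoD(2)[OF lim2 this]]
  obtain r0 where "0 < r0" and r0: "\<And>r. 0 < r \<Longrightarrow> r < r0 \<Longrightarrow> A1 r < ?c \<and> A2 r < ?c"
    unfolding eventually_at_right_field by blast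
  show ?thesis
  proof (rule grad_len_leI[OF \<open>0 < r0\<close>])
    fix w assume r: "0 < dist z w" "dist z w < r0"
    define r where "r = dist z w"
    define p where "p = 1 + lam * r"
    have "0 < r" using r by (simp add: r_def)
    have p: "1 < p" using \<open>0 < lam\<close> \<open>0 < r\<close> by (simp add: p_def)
    have expo: "p / (p - 1) * (C * r\<^sup>2 / 4) = p * (C * r / (4 * lam))"
      using \<open>0 < lam\<close> \<open>0 < r\<close> by (simp add: p_def field_simps power2_eq_square)
    have "kernel_app P f w powr p \<le> exp (p / (p - 1) * (C * (dist w z)\<^sup>2 / 4)) * N p"
      using wh p f unfolding N_def wang_harnack_def by blast
    hence "kernel_app P f w powr p \<le> exp (p * (C * r / (4 * lam))) * N p"
      by (simp only: dist_commute[of w z] r_def[symmetric] expo)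
    hence "ln (kernel_app P f w powr p) \<le> ln (exp (p * (C * r / (4 * lam))) * N p)"
      using Fpos[of w] by (intro ln_mono) auto
    hence "p * ln (kernel_app P f w) \<le> p * (C * r / (4 * lam)) + ln (N p)"
      using Fpos[of w] Npos[of p] p by (simp add: ln_mult_pos ln_powr)
    also have "ln (N p) = p * \<Phi> p" using p by (simp add: \<Phi>_def)
    finally have "p * ln (kernel_app P f w) \<le> p * (C * r / (4 * lam) + \<Phi> p)"
      by (simp add: distrib_left)
    hence "ln (kernel_app P f w) \<le> C * r / (4 * lam) + \<Phi> p" using p by simp
    also have "\<dots> = \<Phi> 1 + r * A1 r"
      using \<open>0 < r\<close> by (simp add: A1_def p_def distrib_left)
    also have "r * A1 r \<le> r * ?c"
      using r0[of r] r \<open>0 < r\<close> by (intro mult_left_mono) (auto simp: r_def)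
    finally have up: "ln (kernel_app P f w) - \<Phi> 1 \<le> ?c * r" by (simp add: mult.commute)
    have "N (1 / p) powr p \<le> exp (p * (C * r / (4 * lam))) * kernel_app P f w"
      using wang_harnack_root[OF p f, of z w] unfolding N_def r_def[symmetric] expo .
    hence "ln (N (1 / p) powr p) \<le> ln (exp (p * (C * r / (4 * lam))) * kernel_app P f w)"
      using Npos[of "1 / p"] p by (intro ln_mono) auto
    hence "p * ln (N (1 / p)) \<le> p * (C * r / (4 * lam)) + ln (kernel_app P f w)"
      using Fpos[of w] Npos[of "1 / p"] p by (simp add: ln_mult_pos ln_powr)
    also have "p * ln (N (1 / p)) = \<Phi> (1 / p)" using p by (simp add: \<Phi>_def)
    finally have "\<Phi> 1 - ln (kernel_app P f w) \<le> p * (C * r / (4 * lam)) + (\<Phi> 1 - \<Phi> (1 / p))"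
      by simp
    also have "\<dots> = r * A2 r"
      using \<open>0 < r\<close> by (simp add: A2_def p_def[symmetric] distrib_left)
    also have "\<dots> \<le> r * ?c"
      using r0[of r] r \<open>0 < r\<close> by (intro mult_left_mono) (auto simp: r_def)
    finally have "\<Phi> 1 - ln (kernel_app P f w) \<le> ?c * r" by (simp add: mult.commute)
    moreover have "\<Phi> 1 = ln (kernel_app P f z)" by (simp add: \<Phi>_def N1)
    ultimately show "\<bar>ln (kernel_app P f z) - ln (kernel_app P f w)\<bar> \<le> ?c * dist z w"
      using up by (simp add: abs_le_iff r_def)
  qed
qed

text \<open>For coinciding points the Harnack inequality says that the \<open>p\<close>-th power mean of \<open>f\<close> is at least its
  mean for all \<open>p > 1\<close>, so the derivative of its logarithm at \<open>p = 1\<close> cannot be negative.\<close>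

lemma entropy_nonneg:
  fixes z :: 'a
  assumes f: "f \<in> Lip_b" "\<And>x. 0 < f x"
  shows "0 \<le> kernel_app P (\<lambda>y. f y * ln (f y)) z / kernel_app P f z - ln (kernel_app P f z)"
    (is "0 \<le> ?E")
proof (rule ccontr)
  assume "\<not> 0 \<le> ?E"
  define N where "N q = kernel_app P (\<lambda>y. f y powr q) z" for q
  have N1: "N 1 = kernel_app P f z" using f(2) by (simp add: N_def less_imp_le)
  have Npos: "0 < N q" if "0 \<le> q" for q
    unfolding N_def by (rule power_mean_deriv(1)[OF f that])
  have "((\<lambda>q. ln (N q) / q) has_real_derivative ?E) (at 1)"
    using power_mean_deriv(2)[OF f, of z] unfolding N_def[symmetric] N1 .
  from has_real_derivative_neg_dec_right[OF this] \<open>\<not> 0 \<le> ?E\<close>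
  obtain d where "0 < d" and d: "\<And>h. 0 < h \<Longrightarrow> h < d \<Longrightarrow> ln (N (1 + h)) / (1 + h) < ln (N 1) / 1"
    by auto
  define p where "p = 1 + d / 2"
  have p: "1 < p" using \<open>0 < d\<close> by (simp add: p_def)
  have "kernel_app P f z powr p \<le> exp (p / (p - 1) * (C * (dist z z)\<^sup>2 / 4)) * N p"
    using wh p f unfolding N_def wang_harnack_def by blast
  hence "N 1 powr p \<le> N p" by (simp add: N1)
  hence "ln (N 1 powr p) \<le> ln (N p)" using Npos[of 1] by (intro ln_mono) auto
  hence "ln (N 1) \<le> ln (N p) / p" using Npos[of 1] p by (simp add: ln_powr field_simps)
  thus False using d[of "d / 2"] \<open>0 < d\<close> by (simp add: p_def)
qed

lemma reverse_log_sobolev: "reverse_log_sobolev P C"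
  unfolding reverse_log_sobolev_def
proof (intro ballI impI allI)
  fix f :: "'a \<Rightarrow> real" and z
  assume f: "f \<in> Lip_b" and "\<forall>x. 0 < f x"
  hence fpos: "\<And>x. 0 < f x" by blast
  let ?F = "kernel_app P f z" and ?G = "grad_len (\<lambda>w. ln (kernel_app P f w)) z"
  define E where "E = kernel_app P (\<lambda>y. f y * ln (f y)) z / ?F - ln ?F"
  have Fpos: "0 < ?F" by (intro kernel_app_pos integrable_Lip_b f fpos)
  have E: "0 \<le> E" unfolding E_def by (rule entropy_nonneg[OF f fpos])
  have slope: "?G \<le> ennreal (C / (4 * lam) + lam * E + e)" if "0 < lam" "0 < e" for lam e
    unfolding E_def by (rule grad_len_ln_kernel_le[OF f fpos that])
  have "?G < top" by (rule le_less_trans[OF slope[of 1 1]]) auto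
  then obtain g where g: "?G = ennreal g" "0 \<le> g" by (cases ?G) auto
  have le: "g \<le> C / (4 * lam) + lam * E" if "0 < lam" for lam
  proof (rule field_le_epsilon)
    fix e :: real assume "0 < e"
    moreover have "0 \<le> C / (4 * lam) + lam * E + e" using E C_pos \<open>0 < e\<close> that by simp
    ultimately show "g \<le> C / (4 * lam) + lam * E + e"
      using slope[OF that, of e] by (simp add: g)
  qed
  have "g\<^sup>2 \<le> C * E"
  proof (cases "g = 0")
    case False
    hence "0 < g" using g by simp
    \<comment> \<open>This \<open>lam\<close> makes the first summand \<open>g / 2\<close>.\<close>
    have "g \<le> C / (4 * (C / (2 * g))) + C / (2 * g) * E"
      using le[of "C / (2 * g)"] C_pos \<open>0 < g\<close> by simp
    thus ?thesis using C_pos \<open>0 < g\<close> by (simp add: field_simps power2_eq_square)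
  qed (use E C_pos in simp)
  hence "?F * g\<^sup>2 \<le> ?F * (C * E)" using Fpos by (intro mult_left_mono) auto
  also have "\<dots> = C * (kernel_app P (\<lambda>y. f y * ln (f y)) z - ?F * ln ?F)"
    using Fpos by (simp add: E_def field_simps)
  finally show "ereal ?F * (enn2ereal ?G)\<^sup>2
      \<le> ereal (C * (kernel_app P (\<lambda>y. f y * ln (f y)) z - ?F * ln ?F))"
    using g by simp
qed

end

section \<open>The equivalence\<close>

theorem theorem5p15:
  fixes P :: "'a::{heine_borel, polish_space} \<Rightarrow> 'a measure" and C :: real
  assumes "length_space TYPE('a)"
    and "markov_kernel P"
    and "C > 0"
  shows "(reverse_log_sobolev P C \<longleftrightarrow> entropic_transport_ineq P C) \<and>
         (entropic_transport_ineq P C \<longleftrightarrow> wang_harnack P C)"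
proof -
  have "entropic_transport_ineq P C" if "reverse_log_sobolev P C"
  proof -
    interpret reverse_log_sobolev_kernel P C by unfold_locales (use assms that in auto)
    show ?thesis by (rule entropic_transport)
  qed
  moreover have "wang_harnack P C" if "entropic_transport_ineq P C"
  proof -
    interpret entropic_transport_kernel P C by unfold_locales (use assms that in auto)
    show ?thesis by (rule wang_harnack)
  qed
  moreover have "reverse_log_sobolev P C" if "wang_harnack P C"
  proof -
    interpret wang_harnack_kernel P C by unfold_locales (use assms that in auto)
    show ?thesis by (rule reverse_log_sobolev)
  qed
  ultimately show ?thesis by blast
qed

end
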